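(* The homogeneous space $X=\mathrm{EIII}=E_6/(Spin(10)\times_{\mathbb{Z}_4}U(1))$ has a two strata decomposition $X=Y_0\cup Y_\infty$, where $Y_0$ is an open $F_4$-orbit and is a complexification of $\mathbb{O}P^2$. The remaining stratum $Y_\infty$ has (complex) co-dimension 1.
   Context: $X$ is regarded as the complex projective variety $G_{\mathbb{C}}/P\subset\mathbb{C}P^{26}=\mathbb{P}(\mathbf{27})$, the orbit under the complex group $E_6$ of the line of an extremal (lowest) weight vector in the 27-dimensional fundamental representation $\mathbf{27}$. $F_4\subset E_6$ is the (complex) subgroup of type $F_4$, under which $\mathbf{27}=\mathbf{26}\oplus\mathbf{1}$; it acts on $X$. The octonion projective plane $\mathbb{O}P^2=F_4^{\rm compact}/Spin(9)$ is the set of $3\times3$ Hermitian octonion matrices $P$ with $P\star P=P$, $\mathrm{Tr}[P]=1$, where $P\star Q=\frac12(PQ+QP)$. Its complexification $(\mathbb{O}P^2)_{\mathbb{C}}$ is given by the same equations $P\star P=P$, $\mathrm{Tr}[P]=1$ for $3\times3$ Hermitian matrices with entries in $\mathbb{C}\otimes\mathbb{O}$, where the octonion conjugation is extended $\mathbb{C}$-linearly (so diagonal entries are in $\mathbb{C}$). *)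

theory Defs
  imports "HOL-Analysis.Analysis"
begin

section \<open>Octonions with coefficients in a commutative ring\<close>

text \<open>
  The octonions over \<^typ>\<open>'a\<close> are the vectors \<^typ>\<open>'a ^ 8\<close> with respect to the basis
  \<open>e\<^sub>0 = 1, e\<^sub>1, \<dots>, e\<^sub>7\<close>, multiplied by the Fano plane rule
  \<open>e\<^sub>i e\<^sub>i\<^sub>+\<^sub>1 = e\<^sub>i\<^sub>+\<^sub>3\<close> (imaginary indices modulo 7, also after cyclic permutation of the three
  units) and \<open>e\<^sub>i\<^sup>2 = -1\<close>.  The case \<^typ>\<open>real\<close> is the division algebra of octonions, the case
  \<^typ>\<open>complex\<close> is its complexification.  The conjugation is linear over \<^typ>\<open>'a\<close>; in
  particular it does not conjugate complex coefficients.
\<close>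

type_synonym 'a oct = "'a ^ 8"

definition oct_scalar :: "'a::zero \<Rightarrow> 'a oct" where
  "oct_scalar c = (\<chi> k. if k = 0 then c else 0)"

definition oct_cnj :: "'a::ab_group_add oct \<Rightarrow> 'a oct" where
  "oct_cnj x = (\<chi> k. if k = 0 then x $ 0 else - x $ k)"

definition oct_mult :: "'a::comm_ring_1 oct \<Rightarrow> 'a oct \<Rightarrow> 'a oct" where
  "oct_mult x y = (\<chi> k.
     let w = (\<lambda>i j. x $ i * y $ j - x $ j * y $ i); s = x $ 0 * y $ k + x $ k * y $ 0 in
     if k = 0 then x $ 0 * y $ 0 - (\<Sum>i\<in>{1, 2, 3, 4, 5, 6, 7}. x $ i * y $ i)
     else if k = 1 then s + w 2 4 + w 3 7 + w 5 6
     else if k = 2 then s + w 3 5 + w 4 1 + w 6 7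
     else if k = 3 then s + w 4 6 + w 5 2 + w 7 1
     else if k = 4 then s + w 5 7 + w 6 3 + w 1 2
     else if k = 5 then s + w 6 1 + w 7 4 + w 2 3
     else if k = 6 then s + w 7 2 + w 1 5 + w 3 4
     else s + w 1 3 + w 2 6 + w 4 5)"

definition oct_norm :: "'a::comm_ring_1 oct \<Rightarrow> 'a" where
  "oct_norm x = (\<Sum>k\<in>UNIV. x $ k * x $ k)"

lemma exhaust_8:
  "(x::8) = 0 \<or> x = 1 \<or> x = 2 \<or> x = 3 \<or> x = 4 \<or> x = 5 \<or> x = 6 \<or> x = 7"
proof (induct x)
  case (of_int z)
  then have "0 \<le> z" and "z < 8" by simp_all
  then have "z = 0 \<or> z = 1 \<or> z = 2 \<or> z = 3 \<or> z = 4 \<or> z = 5 \<or> z = 6 \<or> z = 7" by arith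
  then show ?case by auto
qed

lemma forall_8:
  "(\<forall>x::8. P x) \<longleftrightarrow> P 0 \<and> P 1 \<and> P 2 \<and> P 3 \<and> P 4 \<and> P 5 \<and> P 6 \<and> P 7"
  by (metis exhaust_8)

lemma UNIV_8: "UNIV = {0::8, 1, 2, 3, 4, 5, 6, 7}"
  using exhaust_8 by auto

lemma sum_8:
  "sum f (UNIV::8 set) = f 0 + f 1 + f 2 + f 3 + f 4 + f 5 + f 6 + f 7"
  unfolding UNIV_8 by (simp add: ac_simps)

lemma exhaust_3_0: "(x::3) = 0 \<or> x = 1 \<or> x = 2"
  using exhaust_3[of x] by auto

lemma forall_3_0: "(\<forall>x::3. P x) \<longleftrightarrow> P 0 \<and> P 1 \<and> P 2"
  by (metis exhaust_3_0)

lemma mod_3: "(3::3) = 0" "(4::3) = 1" "(5::3) = 2"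
  by simp_all

lemma sum_3_0: "sum f (UNIV::3 set) = f 0 + f 1 + f 2"
proof -
  have U: "UNIV = {0::3, 1, 2}"
    using exhaust_3_0 by auto
  show ?thesis unfolding U by (simp add: add.assoc)
qed

lemma oct_mult_nth:
  "oct_mult x y $ 0 = x$0 * y$0 - x$1 * y$1 - x$2 * y$2 - x$3 * y$3 - x$4 * y$4 - x$5 * y$5
     - x$6 * y$6 - x$7 * y$7"
  "oct_mult x y $ 1 = x$0 * y$1 + x$1 * y$0 + (x$2 * y$4 - x$4 * y$2) + (x$3 * y$7 - x$7 * y$3)
     + (x$5 * y$6 - x$6 * y$5)"
  "oct_mult x y $ 2 = x$0 * y$2 + x$2 * y$0 + (x$3 * y$5 - x$5 * y$3) + (x$4 * y$1 - x$1 * y$4)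
     + (x$6 * y$7 - x$7 * y$6)"
  "oct_mult x y $ 3 = x$0 * y$3 + x$3 * y$0 + (x$4 * y$6 - x$6 * y$4) + (x$5 * y$2 - x$2 * y$5)
     + (x$7 * y$1 - x$1 * y$7)"
  "oct_mult x y $ 4 = x$0 * y$4 + x$4 * y$0 + (x$5 * y$7 - x$7 * y$5) + (x$6 * y$3 - x$3 * y$6)
     + (x$1 * y$2 - x$2 * y$1)"
  "oct_mult x y $ 5 = x$0 * y$5 + x$5 * y$0 + (x$6 * y$1 - x$1 * y$6) + (x$7 * y$4 - x$4 * y$7)
     + (x$2 * y$3 - x$3 * y$2)"
  "oct_mult x y $ 6 = x$0 * y$6 + x$6 * y$0 + (x$7 * y$2 - x$2 * y$7) + (x$1 * y$5 - x$5 * y$1)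
     + (x$3 * y$4 - x$4 * y$3)"
  "oct_mult x y $ 7 = x$0 * y$7 + x$7 * y$0 + (x$1 * y$3 - x$3 * y$1) + (x$2 * y$6 - x$6 * y$2)
     + (x$4 * y$5 - x$5 * y$4)"
  by (simp_all add: oct_mult_def Let_def)

lemma oct_cnj_nth [simp]:
  "oct_cnj x $ 0 = x $ 0" "k \<noteq> 0 \<Longrightarrow> oct_cnj x $ k = - x $ k"
  by (simp_all add: oct_cnj_def)

lemma oct_scalar_nth [simp]:
  "oct_scalar c $ 0 = c" "k \<noteq> 0 \<Longrightarrow> oct_scalar c $ k = 0"
  by (simp_all add: oct_scalar_def)

text \<open>The multiplication is that of an 8-dimensional composition algebra.\<close>

lemma oct_norm_mult: "oct_norm (oct_mult x y) = oct_norm x * oct_norm (y :: 'a::comm_ring_1 oct)"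
  unfolding oct_norm_def sum_8 oct_mult_nth by (simp add: algebra_simps)


section \<open>Hermitian octonionic matrices\<close>

type_synonym 'a oct_mat = "'a oct ^ 3 ^ 3"

definition oct_mat_mult :: "'a::comm_ring_1 oct_mat \<Rightarrow> 'a oct_mat \<Rightarrow> 'a oct_mat" where
  "oct_mat_mult M N = (\<chi> i j. \<Sum>k\<in>UNIV. oct_mult (M $ i $ k) (N $ k $ j))"

definition hermitian :: "'a::ab_group_add oct_mat \<Rightarrow> bool" where
  "hermitian M \<longleftrightarrow> (\<forall>i j. M $ j $ i = oct_cnj (M $ i $ j))"

definition mat_jordan :: "'a::field_char_0 oct_mat \<Rightarrow> 'a oct_mat \<Rightarrow> 'a oct_mat" where
  "mat_jordan M N = (\<chi> i j. (1 / 2) *s (oct_mat_mult M N $ i $ j + oct_mat_mult N M $ i $ j))"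

text \<open>
  The 27-dimensional space of Hermitian matrices is coordinatised by \<open>'a ^ (3 + 3 \<times> 8)\<close>: for
  \<open>i :: 3\<close> the coordinate \<^term>\<open>Inl i\<close> is the \<open>i\<close>-th diagonal entry and the coordinates
  \<open>Inr (i, _)\<close> form the off-diagonal octonion at position \<open>(i + 1, i + 2)\<close>, indices modulo 3.
  The lemmas \<open>herm_mat_coords\<close>, \<open>herm_coords_mat\<close> and \<open>herm_mat_jordan\<close> below show that this
  identifies the Jordan algebra of Hermitian matrices with its coordinate space.
\<close>

type_synonym 'a albert = "'a ^ (3 + 3 \<times> 8)"

definition offdiag :: "'a albert \<Rightarrow> 3 \<Rightarrow> 'a oct" where
  "offdiag A i = (\<chi> k. A $ Inr (i, k))"

definition herm_mat :: "'a::ab_group_add albert \<Rightarrow> 'a oct_mat" where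
  "herm_mat A = (\<chi> i j.
     if i = j then oct_scalar (A $ Inl i)
     else if j = i + 1 then offdiag A (i + 2)
     else oct_cnj (offdiag A (j + 2)))"

definition herm_coords :: "'a oct_mat \<Rightarrow> 'a albert" where
  "herm_coords M = (\<chi> c. case c of Inl i \<Rightarrow> M $ i $ i $ 0
                                 | Inr (i, k) \<Rightarrow> M $ (i + 1) $ (i + 2) $ k)"

definition jordan :: "'a::field_char_0 albert \<Rightarrow> 'a albert \<Rightarrow> 'a albert"  (infixl "\<star>" 70) where
  "A \<star> B = herm_coords (mat_jordan (herm_mat A) (herm_mat B))"

definition albert_trace :: "'a::ab_group_add albert \<Rightarrow> 'a" where
  "albert_trace A = (\<Sum>i\<in>UNIV. A $ Inl i)"

text \<open>
  The Freudenthal determinant, written through Newton's identities as the third elementary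
  symmetric function of the eigenvalues; see \<open>albert_det_explicit\<close> for the classical formula
  \<open>a\<^sub>0 a\<^sub>1 a\<^sub>2 - \<Sum> a\<^sub>i N(x\<^sub>i) + 2 Re (x\<^sub>0 x\<^sub>1 x\<^sub>2)\<close>.
\<close>

definition albert_det :: "'a::field_char_0 albert \<Rightarrow> 'a" where
  "albert_det A = albert_trace (A \<star> (A \<star> A)) / 3
     - albert_trace (A \<star> A) * albert_trace A / 2 + albert_trace A ^ 3 / 6"

lemma herm_coords_mat: "herm_coords (herm_mat A) = (A :: 'a::ab_group_add albert)"
proof -
  have "herm_mat A $ i $ i $ 0 = A $ Inl i" "herm_mat A $ (i + 1) $ (i + 2) $ k = A $ Inr (i, k)"
    for i k
    using exhaust_3_0[of i] by (auto simp: herm_mat_def offdiag_def mod_3)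
  then show ?thesis
    by (auto simp: vec_eq_iff herm_coords_def split: sum.split)
qed

lemma oct_cnj_cnj [simp]: "oct_cnj (oct_cnj x) = x"
  by (simp add: vec_eq_iff oct_cnj_def)

lemma hermitian_herm_mat: "hermitian (herm_mat (A :: 'a::ab_group_add albert))"
  unfolding hermitian_def forall_3_0 herm_mat_def
  by (simp add: vec_eq_iff oct_cnj_def oct_scalar_def)

lemma herm_mat_coords:
  fixes M :: "'a::field_char_0 oct_mat"
  assumes "hermitian M"
  shows "herm_mat (herm_coords M) = M"
proof -
  have h: "M $ j $ i = oct_cnj (M $ i $ j)" for i j
    using assms unfolding hermitian_def by blast
  have z: "M $ i $ i $ k = 0" if "k \<noteq> 0" for i k
  proof -
    have "M $ i $ i $ k = oct_cnj (M $ i $ i) $ k"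
      using h[of i i] by (rule arg_cong)
    also have "\<dots> = - (M $ i $ i $ k)"
      using that by (rule oct_cnj_nth)
    finally have "2 * M $ i $ i $ k = 0"
      unfolding mult_2 by (rule eq_neg_iff_add_eq_0[THEN iffD1])
    then show ?thesis by simp
  qed
  have d: "oct_scalar (M $ i $ i $ 0) = M $ i $ i" for i
    by (simp add: vec_eq_iff oct_scalar_def z)
  have e: "(\<chi> k. M $ i $ j $ k) = M $ i $ j" for i j
    by (simp add: vec_eq_iff)
  have "herm_mat (herm_coords M) $ i $ j = M $ i $ j" for i j
    using exhaust_3_0[of i] exhaust_3_0[of j]
    apply (elim disjE)
    apply (simp_all add: herm_mat_def herm_coords_def offdiag_def d e mod_3)
    apply (simp_all only: h[symmetric])
    done
  then show ?thesis by (simp add: vec_eq_iff)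
qed

lemma oct_cnj_mult: "oct_cnj (oct_mult x y) = oct_mult (oct_cnj y) (oct_cnj (x :: 'a::comm_ring_1 oct))"
  unfolding vec_eq_iff forall_8
  by (simp add: oct_mult_nth algebra_simps)

lemma oct_cnj_add: "oct_cnj (x + y) = oct_cnj x + oct_cnj y"
  by (simp add: vec_eq_iff oct_cnj_def)

lemma oct_cnj_scale: "oct_cnj (c *s x) = c *s oct_cnj (x :: 'a::comm_ring_1 oct)"
  by (simp add: vec_eq_iff oct_cnj_def)

lemma hermitian_mat_jordan:
  assumes "hermitian M" "hermitian N"
  shows "hermitian (mat_jordan M N)"
proof -
  have h: "M $ j $ i = oct_cnj (M $ i $ j)" "N $ j $ i = oct_cnj (N $ i $ j)" for i j
    using assms unfolding hermitian_def by blast+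
  have "oct_mat_mult M N $ j $ i = oct_cnj (oct_mat_mult N M $ i $ j)" for i j
    by (simp add: oct_mat_mult_def sum_3_0 oct_cnj_add oct_cnj_mult flip: h)
  moreover have "oct_mat_mult N M $ j $ i = oct_cnj (oct_mat_mult M N $ i $ j)" for i j
    by (simp add: oct_mat_mult_def sum_3_0 oct_cnj_add oct_cnj_mult flip: h)
  ultimately have "mat_jordan M N $ j $ i = oct_cnj (mat_jordan M N $ i $ j)" for i j
    by (simp add: mat_jordan_def oct_cnj_add oct_cnj_scale add.commute)
  then show ?thesis unfolding hermitian_def by blast
qed

lemma herm_mat_jordan: "herm_mat (A \<star> B) = mat_jordan (herm_mat A) (herm_mat B)"
  by (simp add: jordan_def herm_mat_coords hermitian_mat_jordan hermitian_herm_mat)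

lemma sum_3_shift: "sum f (UNIV::3 set) = f i + f (i + 1) + (f (i + 2) :: 'a::comm_monoid_add)"
  using exhaust_3_0[of i] by (auto simp: sum_3_0 mod_3 ac_simps)

lemma herm_mat_nth:
  "herm_mat A $ i $ i = oct_scalar (A $ Inl i)"
  "herm_mat A $ i $ (i + 1) = offdiag A (i + 2)"
  "herm_mat A $ (i + 1) $ i = oct_cnj (offdiag A (i + 2))"
  "herm_mat A $ (i + 1) $ (i + 2) = offdiag A i"
  "herm_mat A $ (i + 2) $ (i + 1) = oct_cnj (offdiag A i)"
  "herm_mat A $ (i + 2) $ i = offdiag A (i + 1)"
  "herm_mat A $ i $ (i + 2) = oct_cnj (offdiag A (i + 1))"
  using exhaust_3_0[of i] by (auto simp: herm_mat_def mod_3)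

lemma oct_mult_scalar:
  "oct_mult (oct_scalar c) x = c *s x" "oct_mult x (oct_scalar c) = c *s x"
  unfolding vec_eq_iff forall_8 by (simp_all add: oct_mult_nth mult.commute)

lemma oct_mult_cnj_nth_0:
  "oct_mult x (oct_cnj y) $ 0 = (\<Sum>k\<in>UNIV. x $ k * y $ k)"
  "oct_mult (oct_cnj x) y $ 0 = (\<Sum>k\<in>UNIV. x $ k * y $ k)"
  by (simp_all add: oct_mult_nth sum_8)

lemma jordan_diag:
  fixes A B :: "'a::field_char_0 albert"
  shows "(A \<star> B) $ Inl i = A $ Inl i * B $ Inl i
    + (\<Sum>k\<in>UNIV. offdiag A (i + 1) $ k * offdiag B (i + 1) $ k)
    + (\<Sum>k\<in>UNIV. offdiag A (i + 2) $ k * offdiag B (i + 2) $ k)"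
proof -
  have "(A \<star> B) $ Inl i = (1 / 2) * (oct_mat_mult (herm_mat A) (herm_mat B) $ i $ i $ 0
      + oct_mat_mult (herm_mat B) (herm_mat A) $ i $ i $ 0)"
    by (simp add: jordan_def herm_coords_def mat_jordan_def)
  also have "\<dots> = A $ Inl i * B $ Inl i
    + (\<Sum>k\<in>UNIV. offdiag A (i + 1) $ k * offdiag B (i + 1) $ k)
    + (\<Sum>k\<in>UNIV. offdiag A (i + 2) $ k * offdiag B (i + 2) $ k)"
    unfolding oct_mat_mult_def
    by (simp add: sum_3_shift[of _ i] herm_mat_nth oct_mult_scalar oct_mult_cnj_nth_0
        mult.commute[of "offdiag B _ $ _"] mult.commute[of "B $ _"])
  finally show ?thesis .
qed

lemma offdiag_jordan:
  fixes A B :: "'a::field_char_0 albert"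
  shows "offdiag (A \<star> B) i = (1 / 2) *s
    ((A $ Inl (i + 1) + A $ Inl (i + 2)) *s offdiag B i
     + (B $ Inl (i + 1) + B $ Inl (i + 2)) *s offdiag A i
     + oct_cnj (oct_mult (offdiag A (i + 1)) (offdiag B (i + 2))
        + oct_mult (offdiag B (i + 1)) (offdiag A (i + 2))))"
proof -
  have "offdiag (A \<star> B) i
      = (1 / 2) *s (oct_mat_mult (herm_mat A) (herm_mat B) $ (i + 1) $ (i + 2)
        + oct_mat_mult (herm_mat B) (herm_mat A) $ (i + 1) $ (i + 2))"
    by (simp add: jordan_def herm_coords_def mat_jordan_def offdiag_def vec_eq_iff)
  also have "\<dots> = (1 / 2) *s
    ((A $ Inl (i + 1) + A $ Inl (i + 2)) *s offdiag B i
     + (B $ Inl (i + 1) + B $ Inl (i + 2)) *s offdiag A i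
     + oct_cnj (oct_mult (offdiag A (i + 1)) (offdiag B (i + 2))
        + oct_mult (offdiag B (i + 1)) (offdiag A (i + 2))))"
    unfolding oct_mat_mult_def
    by (simp add: sum_3_shift[of _ i] herm_mat_nth oct_mult_scalar oct_cnj_add oct_cnj_mult
        vec.scale_left_distrib vec.scale_right_distrib)
  finally show ?thesis .
qed

lemma oct_trilinear_cyclic:
  "oct_mult (oct_mult x y) z $ 0 = oct_mult (oct_mult y z) (x :: 'a::comm_ring_1 oct) $ 0"
  unfolding oct_mult_nth by (simp add: algebra_simps)

lemma sum_offdiag_square:
  "(\<Sum>k\<in>UNIV. offdiag A i $ k * offdiag (A \<star> (A::'a::field_char_0 albert)) i $ k)
    = (A $ Inl (i + 1) + A $ Inl (i + 2)) * oct_norm (offdiag A i)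
      + oct_mult (oct_mult (offdiag A 0) (offdiag A 1)) (offdiag A 2) $ 0"
proof -
  have c: "oct_mult (oct_mult (offdiag A (i + 1)) (offdiag A (i + 2))) (offdiag A i) $ 0
      = oct_mult (oct_mult (offdiag A 0) (offdiag A 1)) (offdiag A 2) $ 0"
    using exhaust_3_0[of i]
    by (auto simp: mod_3) (metis oct_trilinear_cyclic)+
  have "offdiag (A \<star> A) i = (A $ Inl (i + 1) + A $ Inl (i + 2)) *s offdiag A i
      + oct_cnj (oct_mult (offdiag A (i + 1)) (offdiag A (i + 2)))"
    unfolding offdiag_jordan by (simp add: vec_eq_iff oct_cnj_def field_simps)
  then show ?thesis
    by (simp add: oct_norm_def sum.distrib sum_distrib_left algebra_simps
        flip: c oct_mult_cnj_nth_0(2)[of "oct_cnj _", simplified])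
qed

lemma albert_det_explicit:
  fixes A :: "'a::field_char_0 albert"
  shows "albert_det A = A $ Inl 0 * A $ Inl 1 * A $ Inl 2
    - (\<Sum>i\<in>UNIV. A $ Inl i * oct_norm (offdiag A i))
    + 2 * oct_mult (oct_mult (offdiag A 0) (offdiag A 1)) (offdiag A 2) $ 0"
proof -
  have "(A \<star> A) $ Inl i = A $ Inl i ^ 2 + oct_norm (offdiag A (i + 1)) + oct_norm (offdiag A (i + 2))" for i
    by (simp add: jordan_diag oct_norm_def power2_eq_square)
  then show ?thesis
    unfolding albert_det_def albert_trace_def sum_3_0 jordan_diag[of A "A \<star> A"] sum_offdiag_square
    by (simp add: mod_3 field_simps power2_eq_square power3_eq_cube)
qed


section \<open>The octonionic projective plane and its complexification\<close>

text \<open>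
  For \<^typ>\<open>real\<close> coefficients this is the compact plane \<open>OP\<^sup>2\<close>; for \<^typ>\<open>complex\<close>
  coefficients the same equations define \<open>(OP\<^sup>2)\<^sub>\<complex>\<close>, whose real points are \<open>OP\<^sup>2\<close> by
  \<open>OP2_real_points\<close>.
\<close>

definition OP2 :: "'a::field_char_0 albert set" where
  "OP2 = {P. P \<star> P = P \<and> albert_trace P = 1}"

definition complexify :: "real albert \<Rightarrow> complex albert" where
  "complexify A = (\<chi> c. of_real (A $ c))"

lemma complexify_jordan: "complexify A \<star> complexify B = complexify (A \<star> B)"
proof -
  have o: "offdiag (complexify A) i $ k = of_real (offdiag A i $ k)" for A i k
    by (simp add: offdiag_def complexify_def)
  have m: "oct_mult (offdiag (complexify A) i) (offdiag (complexify B) j) $ k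
      = of_real (oct_mult (offdiag A i) (offdiag B j) $ k)" for A B i j k
    using exhaust_8[of k] by (auto simp: oct_mult_nth o)
  have "(complexify A \<star> complexify B) $ Inl i = complexify (A \<star> B) $ Inl i" for i
    by (simp add: jordan_diag o) (simp add: complexify_def jordan_diag)
  moreover have "offdiag (complexify A \<star> complexify B) i $ k = offdiag (complexify (A \<star> B)) i $ k" for i k
    unfolding o by (cases "k = 0") (simp_all add: offdiag_jordan o m, simp_all add: complexify_def)
  ultimately show ?thesis
    by (auto simp: vec_eq_iff offdiag_def split: sum.splits) (metis obj_sumE surj_pair)
qed

lemma OP2_real_points: "{P :: complex albert. P \<in> OP2 \<and> (\<forall>c. P $ c \<in> \<real>)} = complexify ` OP2"
proof -
  have inj: "complexify A = complexify B \<longleftrightarrow> A = B" for A B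
    by (simp add: complexify_def vec_eq_iff)
  have tr: "albert_trace (complexify A) = of_real (albert_trace A)" for A
    by (simp add: albert_trace_def complexify_def)
  have iff: "complexify A \<in> OP2 \<longleftrightarrow> A \<in> OP2" for A
    by (simp add: OP2_def complexify_jordan inj tr)
  have re: "P = complexify (\<chi> c. Re (P $ c))" if "\<forall>c. P $ c \<in> \<real>" for P :: "complex albert"
    using that by (simp add: complexify_def vec_eq_iff)
  show ?thesis
  proof (intro equalityI subsetI)
    fix P :: "complex albert" assume "P \<in> {P. P \<in> OP2 \<and> (\<forall>c. P $ c \<in> \<real>)}"
    then show "P \<in> complexify ` OP2"
      using re[of P] iff by (metis (mono_tags, lifting) image_eqI mem_Collect_eq)
  next
    fix P :: "complex albert" assume "P \<in> complexify ` OP2"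
    then show "P \<in> {P. P \<in> OP2 \<and> (\<forall>c. P $ c \<in> \<real>)}"
      using iff by (auto simp: complexify_def)
  qed
qed


section \<open>The groups of type \<open>E\<^sub>6\<close> and \<open>F\<^sub>4\<close>\<close>

text \<open>
  The simply connected complex group \<open>E\<^sub>6\<close> in its 27-dimensional representation is the group of
  linear automorphisms of the cubic form \<^const>\<open>albert_det\<close>.  Its subgroup \<open>F\<^sub>4\<close> is the
  automorphism group of the Jordan algebra; it fixes the identity matrix and preserves the
  trace, which gives \<open>27 = 26 \<oplus> 1\<close>.
\<close>

definition E6 :: "(complex albert \<Rightarrow> complex albert) set" where
  "E6 = {g. Vector_Spaces.linear (*s) (*s) g \<and> bij g \<and> (\<forall>A. albert_det (g A) = albert_det A)}"

definition F4 :: "(complex albert \<Rightarrow> complex albert) set" where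
  "F4 = {g \<in> E6. \<forall>A B. g (A \<star> B) = g A \<star> g B}"

text \<open>
  Extremal weights are the vertices of the weight polytope, i.e. the weights at which some
  one-parameter subgroup \<open>\<rho>\<close> of a maximal torus attains its minimum on the weights and at no other
  weight; they have multiplicity one.  As every algebraic one-parameter subgroup \<open>\<complex>\<^sup>* \<rightarrow> E\<^sub>6\<close> lies
  in a maximal torus, an extremal weight vector (equivalently: a lowest weight vector for some
  choice of maximal torus and positive roots) is a vector that spans the lowest weight space of
  such a \<open>\<rho>\<close>.  That \<open>\<rho>\<close> is algebraic means that the space is the sum of its integral weight spaces.
\<close>

definition weight_space :: "(complex \<Rightarrow> complex albert \<Rightarrow> complex albert) \<Rightarrow> int \<Rightarrow> complex albert set" where
  "weight_space \<rho> k = {A. \<forall>t. t \<noteq> 0 \<longrightarrow> \<rho> t A = (t powi k) *s A}"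

definition one_parameter_subgroup :: "(complex \<Rightarrow> complex albert \<Rightarrow> complex albert) \<Rightarrow> bool" where
  "one_parameter_subgroup \<rho> \<longleftrightarrow>
     (\<forall>t. t \<noteq> 0 \<longrightarrow> \<rho> t \<in> E6) \<and>
     (\<forall>s t. s \<noteq> 0 \<longrightarrow> t \<noteq> 0 \<longrightarrow> \<rho> (s * t) = \<rho> s \<circ> \<rho> t) \<and>
     vec.span (\<Union>k. weight_space \<rho> k) = UNIV"

definition extremal_weight_vector :: "complex albert \<Rightarrow> bool" where
  "extremal_weight_vector v \<longleftrightarrow> v \<noteq> 0 \<and>
     (\<exists>\<rho> m. one_parameter_subgroup \<rho> \<and> weight_space \<rho> m = vec.span {v} \<and>
        (\<forall>k<m. weight_space \<rho> k = {0}))"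

text \<open>The diagonal matrix \<open>diag(1, 0, 0)\<close> is an example.\<close>

lemma extremal_weight_vector_diag: "extremal_weight_vector (axis (Inl 0) 1)"
proof -
  define w :: "3 + 3 \<times> 8 \<Rightarrow> int" where
    "w c = (case c of Inl i \<Rightarrow> if i = 0 then - 4 else 2 | Inr (i, k) \<Rightarrow> if i = 0 then 2 else - 1)" for c
  define \<rho> where "\<rho> t A = (\<chi> c. t powi w c * A $ c)" for t :: complex and A :: "complex albert"
  have E6: "\<rho> t \<in> E6" if "t \<noteq> 0" for t
  proof -
    have "Vector_Spaces.linear (*s) (*s) (\<rho> t)"
      by unfold_locales (simp_all add: \<rho>_def vec_eq_iff algebra_simps)
    moreover have "bij (\<rho> t)"
      by (rule o_bij[of "\<rho> (inverse t)"])
        (use that in \<open>auto simp: \<rho>_def vec_eq_iff fun_eq_iff power_int_inverse\<close>)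
    moreover have "albert_det (\<rho> t A) = albert_det A" for A
    proof -
      have o: "offdiag (\<rho> t A) i $ k = (if i = 0 then t powi 2 else t powi - 1) * offdiag A i $ k" for i k
        by (simp add: offdiag_def \<rho>_def w_def)
      have d: "\<rho> t A $ Inl i = (if i = 0 then t powi - 4 else t powi 2) * A $ Inl i" for i
        by (simp add: \<rho>_def w_def)
      have n: "oct_norm (offdiag (\<rho> t A) i) = (if i = 0 then t powi 4 else t powi - 2) * oct_norm (offdiag A i)" for i
        using that by (auto simp: oct_norm_def o sum_distrib_left power_int_minus field_simps power2_eq_square power4_eq_xxxx)
      have m: "oct_mult (oct_mult (offdiag (\<rho> t A) 0) (offdiag (\<rho> t A) 1)) (offdiag (\<rho> t A) 2) $ 0
          = oct_mult (oct_mult (offdiag A 0) (offdiag A 1)) (offdiag A 2) $ 0"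
      proof -
        have "offdiag (\<rho> t A) 0 = t powi 2 *s offdiag A 0" "offdiag (\<rho> t A) 1 = t powi - 1 *s offdiag A 1"
          "offdiag (\<rho> t A) 2 = t powi - 1 *s offdiag A 2"
          by (simp_all add: vec_eq_iff o)
        moreover have "oct_mult (c *s x) y = c *s oct_mult x y" "oct_mult x (c *s y) = c *s oct_mult x y"
          for c :: complex and x y
          unfolding vec_eq_iff forall_8 by (simp_all add: oct_mult_nth algebra_simps)
        ultimately show ?thesis
          using that by (simp add: power_int_minus power2_eq_square field_simps)
      qed
      show ?thesis
        unfolding albert_det_explicit sum_3_0 n m d
        using that by (simp add: power_int_minus field_simps flip: power_add)
    qed
    ultimately show ?thesis by (simp add: E6_def)
  qed
  have hom: "\<rho> (s * t) = \<rho> s \<circ> \<rho> t" for s t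
    by (auto simp: fun_eq_iff \<rho>_def vec_eq_iff power_int_mult_distrib)
  have ax: "axis c 1 \<in> weight_space \<rho> (w c)" for c
    by (auto simp: weight_space_def \<rho>_def vec_eq_iff axis_def)
  have "vec.span (\<Union>k. weight_space \<rho> k) = UNIV"
  proof -
    have "cart_basis \<subseteq> (\<Union>k. weight_space \<rho> k)"
      using ax by (auto simp: cart_basis_def)
    then have "vec.span cart_basis \<subseteq> vec.span (\<Union>k. weight_space \<rho> k)"
      by (rule vec.span_mono)
    then show ?thesis by (auto simp: vec.span_Basis)
  qed
  then have ops: "one_parameter_subgroup \<rho>"
    using E6 hom by (simp add: one_parameter_subgroup_def)
  have ws: "A $ c = 0" if "A \<in> weight_space \<rho> k" "w c \<noteq> k" for A k c
  proof -
    have "2 powi w c * A $ c = 2 powi k * A $ c"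
      using that(1) unfolding weight_space_def \<rho>_def by (auto simp: vec_eq_iff)
    moreover have "(2::complex) powi w c \<noteq> 2 powi k"
    proof
      assume "(2::complex) powi w c = 2 powi k"
      then have "norm ((2::complex) powi w c) = norm ((2::complex) powi k)" by simp
      then have "(2::real) powi w c = 2 powi k" by (simp add: norm_power_int)
      then show False
        using that(2) power_int_strict_increasing[of "w c" k "2::real"]
          power_int_strict_increasing[of k "w c" "2::real"]
        by (cases "w c < k") auto
    qed
    ultimately show ?thesis by simp
  qed
  have w4: "w c > - 4" if "c \<noteq> Inl 0" for c
    using that by (auto simp: w_def split: sum.split)
  have "weight_space \<rho> (- 4) = vec.span {axis (Inl 0) 1}"
  proof (intro equalityI subsetI)
    fix A assume A: "A \<in> weight_space \<rho> (- 4)"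
    have "A = A $ Inl 0 *s axis (Inl 0) 1"
      using ws[OF A] w4 by (fastforce simp: vec_eq_iff axis_def)
    then show "A \<in> vec.span {axis (Inl 0) 1}"
      by (metis vec.span_base vec.span_scale singletonI)
  next
    fix A :: "complex albert" assume "A \<in> vec.span {axis (Inl 0) 1}"
    then obtain c where "A = c *s axis (Inl 0) 1"
      by (auto simp: vec.span_singleton)
    moreover have "w (Inl 0) = - 4" by (simp add: w_def)
    ultimately show "A \<in> weight_space \<rho> (- 4)"
      by (auto simp: weight_space_def \<rho>_def vec_eq_iff axis_def)
  qed
  moreover have "weight_space \<rho> k = {0}" if "k < - 4" for k
  proof -
    have "w c \<noteq> k" for c
      using that w4[of c] by (cases "c = Inl 0") (auto simp: w_def)
    then have "A = 0" if "A \<in> weight_space \<rho> k" for A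
      using ws[OF that] by (simp add: vec_eq_iff)
    moreover have "0 \<in> weight_space \<rho> k"
      by (simp add: weight_space_def \<rho>_def vec_eq_iff)
    ultimately show ?thesis by blast
  qed
  moreover have "axis (Inl 0) 1 \<noteq> (0 :: complex albert)"
    by (simp add: axis_eq_0_iff)
  ultimately show ?thesis
    using ops unfolding extremal_weight_vector_def by blast
qed


section \<open>Complex projective space\<close>

text \<open>
  Points are the complex lines \<^term>\<open>vec.span {v}\<close> with \<^term>\<open>v \<noteq> 0\<close>, with the quotient topology.
\<close>

definition proj_space :: "(complex ^ 'n) set set" where
  "proj_space = {vec.span {v} |v. v \<noteq> 0}"

definition proj_topology :: "(complex ^ 'n) set topology" where
  "proj_topology = topology (\<lambda>U. U \<subseteq> proj_space \<and> open {v. v \<noteq> 0 \<and> vec.span {v} \<in> U})"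

lemma openin_proj_topology:
  "openin proj_topology U \<longleftrightarrow> U \<subseteq> proj_space \<and> open {v :: complex ^ 'n. v \<noteq> 0 \<and> vec.span {v} \<in> U}"
proof -
  have "istopology (\<lambda>U. U \<subseteq> proj_space \<and> open {v :: complex ^ 'n. v \<noteq> 0 \<and> vec.span {v} \<in> U})"
    unfolding istopology_def
  proof (intro conjI allI impI)
    fix S T :: "(complex ^ 'n) set set"
    assume *: "S \<subseteq> proj_space \<and> open {v. v \<noteq> 0 \<and> vec.span {v} \<in> S}"
      "T \<subseteq> proj_space \<and> open {v. v \<noteq> 0 \<and> vec.span {v} \<in> T}"
    have "{v. v \<noteq> 0 \<and> vec.span {v} \<in> S \<inter> T}
        = {v. v \<noteq> 0 \<and> vec.span {v} \<in> S} \<inter> {v. v \<noteq> 0 \<and> vec.span {v} \<in> T}" by auto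
    then show "open {v. v \<noteq> 0 \<and> vec.span {v} \<in> S \<inter> T}" using * by (simp only: open_Int)
    show "S \<inter> T \<subseteq> proj_space" using * by (simp add: le_infI1)
  next
    fix K :: "(complex ^ 'n) set set set"
    assume *: "\<forall>U\<in>K. U \<subseteq> proj_space \<and> open {v. v \<noteq> 0 \<and> vec.span {v} \<in> U}"
    have "{v. v \<noteq> 0 \<and> vec.span {v} \<in> \<Union> K} = (\<Union>U\<in>K. {v. v \<noteq> 0 \<and> vec.span {v} \<in> U})" by auto
    moreover have "open (\<Union>U\<in>K. {v. v \<noteq> 0 \<and> vec.span {v} \<in> U})"
      using * by (intro open_UN) simp
    ultimately show "open {v. v \<noteq> 0 \<and> vec.span {v} \<in> \<Union> K}" by simp
    show "\<Union> K \<subseteq> proj_space" using * by (simp add: Sup_le_iff)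
  qed
  then show ?thesis by (simp add: proj_topology_def topology_inverse')
qed

definition line_orbit :: "('a \<Rightarrow> 'a) set \<Rightarrow> 'a set \<Rightarrow> 'a set set" where
  "line_orbit G L = {g ` L |g. g \<in> G}"


section \<open>Holomorphic maps and complex submanifolds\<close>

definition has_complex_derivative ::
    "(complex ^ 'n \<Rightarrow> complex) \<Rightarrow> (complex ^ 'n \<Rightarrow> complex) \<Rightarrow> complex ^ 'n \<Rightarrow> bool" where
  "has_complex_derivative f D x \<longleftrightarrow>
     Vector_Spaces.linear (*s) (*) D \<and> (f has_derivative D) (at x)"

definition holomorphic_fun_on :: "(complex ^ 'n \<Rightarrow> complex) \<Rightarrow> (complex ^ 'n) set \<Rightarrow> bool" where
  "holomorphic_fun_on f U \<longleftrightarrow> (\<forall>x\<in>U. \<exists>D. has_complex_derivative f D x)"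

definition holomorphic_map_on :: "(complex ^ 'n \<Rightarrow> complex ^ 'm) \<Rightarrow> (complex ^ 'n) set \<Rightarrow> bool" where
  "holomorphic_map_on f U \<longleftrightarrow> (\<forall>i. holomorphic_fun_on (\<lambda>x. f x $ i) U)"

text \<open>
  \<open>S\<close> is a complex submanifold of dimension \<open>d\<close> of \<open>\<complex>\<^sup>n\<close>: locally it is cut out by \<open>n - d\<close>
  holomorphic equations whose differentials at the given point are linearly independent.
\<close>

definition complex_submanifold :: "nat \<Rightarrow> (complex ^ 'n) set \<Rightarrow> bool" where
  "complex_submanifold d S \<longleftrightarrow> (\<exists>k. k + d = CARD('n) \<and>
     (\<forall>p\<in>S. \<exists>U F D. open U \<and> p \<in> U \<and>
        (\<forall>i<k. holomorphic_fun_on (F i) U \<and> has_complex_derivative (F i) (D i) p) \<and>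
        S \<inter> U = {x \<in> U. \<forall>i<k. F i x = 0} \<and>
        (\<forall>c. (\<forall>h. (\<Sum>i<k. c i * D i h) = 0) \<longrightarrow> (\<forall>i<k. c i = 0))))"

text \<open>
  A complex submanifold of projective space, tested in the affine charts
  \<open>{v. \<phi> v = 1} \<rightarrow> \<P>\<close>, \<open>v \<mapsto> [v]\<close>, where \<open>\<phi>\<close> is a linear form.
\<close>

definition proj_submanifold :: "nat \<Rightarrow> (complex ^ 'n) set set \<Rightarrow> bool" where
  "proj_submanifold d M \<longleftrightarrow> M \<subseteq> proj_space \<and>
     (\<forall>\<phi>. Vector_Spaces.linear (*s) (*) \<phi> \<longrightarrow>
        complex_submanifold d {v. \<phi> v = 1 \<and> vec.span {v} \<in> M})"

text \<open>The empty set is excluded because it is a submanifold of every dimension.\<close>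

definition has_complex_codim :: "nat \<Rightarrow> (complex ^ 'n) set set \<Rightarrow> (complex ^ 'n) set set \<Rightarrow> bool" where
  "has_complex_codim c M N \<longleftrightarrow> M \<noteq> {} \<and> M \<subseteq> N \<and>
     (\<exists>d. proj_submanifold (d + c) N \<and> proj_submanifold d M)"

text \<open>
  Biholomorphic maps between a subset \<open>S\<close> of \<open>\<complex>\<^sup>n\<close> and a subset \<open>M\<close> of a projective space:
  bijections that are, in both directions, locally the restriction of holomorphic maps of the
  ambient spaces.
\<close>

definition holomorphic_into_proj ::
    "(complex ^ 'n \<Rightarrow> (complex ^ 'm) set) \<Rightarrow> (complex ^ 'n) set \<Rightarrow> bool" where
  "holomorphic_into_proj f S \<longleftrightarrow>
     (\<forall>p\<in>S. \<exists>U F. open U \<and> p \<in> U \<and> holomorphic_map_on F U \<and>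
        (\<forall>x\<in>U \<inter> S. F x \<noteq> 0 \<and> f x = vec.span {F x}))"

definition holomorphic_from_proj ::
    "((complex ^ 'm) set \<Rightarrow> complex ^ 'n) \<Rightarrow> (complex ^ 'm) set set \<Rightarrow> bool" where
  "holomorphic_from_proj g M \<longleftrightarrow>
     (\<forall>v. v \<noteq> 0 \<and> vec.span {v} \<in> M \<longrightarrow>
        (\<exists>U G. open U \<and> v \<in> U \<and> holomorphic_map_on G U \<and>
           (\<forall>x\<in>U. x \<noteq> 0 \<and> vec.span {x} \<in> M \<longrightarrow> g (vec.span {x}) = G x)))"

definition biholomorphic_to_proj ::
    "(complex ^ 'n \<Rightarrow> (complex ^ 'm) set) \<Rightarrow> (complex ^ 'n) set \<Rightarrow> (complex ^ 'm) set set \<Rightarrow> bool" where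
  "biholomorphic_to_proj f S M \<longleftrightarrow> bij_betw f S M \<and>
     holomorphic_into_proj f S \<and> holomorphic_from_proj (inv_into S f) M"

definition complexification_of_OP2 :: "complex albert set set \<Rightarrow> bool" where
  "complexification_of_OP2 Y \<longleftrightarrow>
     (\<exists>f. biholomorphic_to_proj f OP2 Y \<and> (\<forall>g\<in>F4. \<forall>P\<in>OP2. f (g P) = g ` f P))"

end

theory Submission
  imports Defs
begin

text \<open>
Write \<open>A \<times> B\<close> for the symmetric product (\<open>cross\<close>) for which \<open>A \<times> A\<close> is twice the adjoint \<open>A\<^sup>#\<close>, \<open>T\<close> for the
trace form and \<open>N(A, B, C) = T(A \<times> B, C)\<close> for the symmetric trilinear form with \<open>N(A, A, A) = 6 det A\<close>.  The cone over
\<open>X\<close> consists of the elements of rank one, that is of the nonzero \<open>v\<close> with \<open>v \<times> v = 0\<close>, and the two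
strata are distinguished by the vanishing of the trace.

That an extremal weight vector \<open>v\<close> has rank one (\<open>extremal_imp_cross_eq_0\<close>) is seen on weights.
Let \<open>v\<close> span the lowest weight space, of weight \<open>m\<close>, and suppose \<open>v \<times> v \<noteq> 0\<close>.  Then \<open>N(v, v, h) \<noteq> 0\<close>
for a weight vector \<open>h\<close>, whose weight is \<open>-2m\<close>.  The bilinear form \<open>N(h, _, _)\<close> pairs only weights with
sum \<open>2m\<close>, hence only the weight \<open>m\<close> with itself, and so it has rank at most one.  But the diagonal
idempotents \<open>E\<close> are isotropic for this form and \<open>h \<times> E\<close> does not vanish for all three of them, which
forces a hyperbolic plane.

Row operations \<open>A \<mapsto> T A T\<^sup>*\<close>, with \<open>T\<close> differing from the identity in one off-diagonal octonion,
preserve the determinant.  Gaussian elimination with them shows that \<open>E\<^sub>6\<close> acts transitively on the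
elements of rank one (\<open>E6_transitive\<close>), so that \<open>X\<close> is the set of all lines of rank one.

An element of \<open>E\<^sub>6\<close> that fixes the identity matrix \<open>1\<close> preserves trace, trace form and adjoint, and the
Jordan product is expressed by these; so it lies in \<open>F\<^sub>4\<close> (\<open>F4I\<close>).  The equations of the complexified
plane are equivalent to \<open>P \<times> P = 0\<close>, \<open>tr P = 1\<close> (\<open>OP2_iff\<close>).  If \<open>P\<close> satisfies them and
\<open>g P = diag(1, 0, 0)\<close> with \<open>g\<close> in \<open>E\<^sub>6\<close>, then \<open>tr P = 1\<close> says that the lower right minor of \<open>B = g 1\<close> is 1,
and elimination inside the stabilizer of \<open>diag(1, 0, 0)\<close> brings \<open>B\<close> to \<open>1\<close>.  Hence \<open>F\<^sub>4\<close> is transitive on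
the plane (\<open>F4_transitive\<close>).  As every line of rank one with nonzero trace contains exactly one point
of the plane, \<open>P \<mapsto> [P]\<close> is a biholomorphic map onto the open stratum, with inverse
\<open>[v] \<mapsto> v / tr v\<close>.

For the dimensions, the cone of rank one is near \<open>diag(1, 0, 0)\<close> the zero set of ten of the 27 entries
of \<open>v \<times> v\<close>, with independent differentials; by transitivity this describes it near every point.  Its
tangent space at \<open>p\<close> is \<open>{w. p \<times> w = 0}\<close>, and linear equations that are independent on the tangent
spaces cut out submanifolds (\<open>linear_section_submanifold\<close>).  In an affine chart, \<open>X\<close> is given by one such
equation and the stratum of trace zero by two, because the trace does not vanish identically on any
of these tangent spaces (\<open>exists_tangent_trace_nonzero\<close>).
\<close>


section \<open>Octonion identities\<close>

definition oct_inner :: "'a::comm_ring_1 oct \<Rightarrow> 'a oct \<Rightarrow> 'a" where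
  "oct_inner x y = (\<Sum>k\<in>UNIV. x $ k * y $ k)"

lemma oct_inner_expand: "oct_inner x y = x$0 * y$0 + x$1 * y$1 + x$2 * y$2 + x$3 * y$3
    + x$4 * y$4 + x$5 * y$5 + x$6 * y$6 + x$7 * y$7"
  by (simp add: oct_inner_def sum_8)

lemma oct_inner_linear [simp]:
  "oct_inner (x + y) z = oct_inner x z + oct_inner y z"
  "oct_inner z (x + y) = oct_inner z x + oct_inner z y"
  "oct_inner (x - y) z = oct_inner x z - oct_inner y z"
  "oct_inner z (x - y) = oct_inner z x - oct_inner z y"
  "oct_inner (- x) z = - oct_inner x z"
  "oct_inner z (- x) = - oct_inner z x"
  "oct_inner (c *s x) z = c * oct_inner x z"
  "oct_inner z (c *s x) = c * oct_inner z x"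
  "oct_inner 0 z = 0" "oct_inner z 0 = 0"
  by (simp_all add: oct_inner_def sum.distrib sum_subtractf sum_negf sum_distrib_left algebra_simps)

lemma oct_inner_commute: "oct_inner x y = oct_inner y x"
  by (simp add: oct_inner_def mult.commute)

lemma oct_inner_self: "oct_inner x x = oct_norm x"
  by (simp add: oct_inner_def oct_norm_def)

lemma oct_inner_axis [simp]:
  "oct_inner (axis k 1) x = x $ k" "oct_inner x (axis k 1) = x $ k"
  by (simp_all add: oct_inner_def axis_def if_distrib if_distribR cong: if_cong)

lemma oct_norm_add: "oct_norm (x + y) = oct_norm x + 2 * oct_inner x y + oct_norm y"
  by (simp add: oct_inner_commute flip: oct_inner_self)

lemma oct_norm_scale: "oct_norm (c *s x) = c ^ 2 * oct_norm x"
  by (simp add: power2_eq_square flip: oct_inner_self)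

lemma oct_norm_cnj [simp]: "oct_norm (oct_cnj x) = oct_norm x"
  by (simp add: oct_norm_def sum_8)

lemma oct_cnj_linear [simp]: "oct_cnj 0 = 0" "oct_cnj (- x) = - oct_cnj x"
  "oct_cnj (x - y) = oct_cnj x - oct_cnj y"
  by (simp_all add: vec_eq_iff oct_cnj_def)

lemma oct_mult_linear [simp]:
  "oct_mult (x + y) z = oct_mult x z + oct_mult y z"
  "oct_mult z (x + y) = oct_mult z x + oct_mult z y"
  "oct_mult (c *s x) z = c *s oct_mult x z"
  "oct_mult z (c *s x) = c *s oct_mult z x"
  "oct_mult 0 z = 0" "oct_mult z 0 = 0"
  unfolding vec_eq_iff forall_8 by (simp_all add: oct_mult_nth algebra_simps)

lemma oct_alternative:
  "oct_mult (oct_cnj x) (oct_mult x y) = oct_norm x *s y"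
  "oct_mult (oct_mult y x) (oct_cnj x) = oct_norm x *s y"
  unfolding vec_eq_iff forall_8 oct_norm_def sum_8
  by (simp_all add: oct_mult_nth algebra_simps)

lemma oct_inner_cnj_mult:
  "oct_inner (oct_cnj (oct_mult x y)) z = oct_mult (oct_mult x y) z $ 0"
  "oct_inner z (oct_cnj (oct_mult x y)) = oct_mult (oct_mult x y) z $ 0"
  by (simp_all add: oct_inner_expand oct_mult_nth(1))

lemma oct_inner_mult_cancel:
  fixes x y z :: "'a::field_char_0 oct"
  shows "oct_inner (oct_mult x z) (oct_mult y z) = oct_inner x y * oct_norm z"
    and "oct_inner (oct_mult z x) (oct_mult z y) = oct_inner x y * oct_norm z"
proof -
  have "oct_norm (oct_mult (x + y) z) = oct_norm (x + y) * oct_norm z"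
    "oct_norm (oct_mult z (x + y)) = oct_norm z * oct_norm (x + y)"
    by (rule oct_norm_mult)+
  then show "oct_inner (oct_mult x z) (oct_mult y z) = oct_inner x y * oct_norm z"
    and "oct_inner (oct_mult z x) (oct_mult z y) = oct_inner x y * oct_norm z"
    by (simp_all add: oct_norm_add oct_norm_mult algebra_simps)
qed


section \<open>The adjoint product and the polarised determinant\<close>

lemma offdiag_linear [simp]:
  "offdiag (A + B) i = offdiag A i + offdiag B i"
  "offdiag (A - B) i = offdiag A i - offdiag B i"
  "offdiag (- A) i = - offdiag A i"
  "offdiag (c *s A) i = c *s offdiag A i"
  "offdiag 0 i = 0"
  by (simp_all add: offdiag_def vec_eq_iff)

lemma offdiag_axis [simp]:
  "offdiag (axis (Inl i) c) j = 0"
  "offdiag (axis (Inr (i, k)) c) j = (if i = j then axis k c else 0)"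
  by (auto simp: offdiag_def vec_eq_iff axis_def)

lemma offdiag_nth: "offdiag A i $ k = A $ Inr (i, k)"
  by (simp add: offdiag_def)

lemma axis_nth_if: "axis c a $ d = (if d = c then a else 0)"
  by (simp add: axis_def)

lemma albert_eqI:
  assumes "\<And>i. A $ Inl i = B $ Inl i" "\<And>i. offdiag A i = offdiag B i"
  shows "A = B"
proof -
  have "A $ c = B $ c" for c
    using assms(1) arg_cong[OF assms(2), of "\<lambda>x. x $ k" for k]
    by (cases c) (auto simp: offdiag_def)
  then show ?thesis by (simp add: vec_eq_iff)
qed

lemma albert_eq_iff_3:
  "A = B \<longleftrightarrow> A $ Inl 0 = B $ Inl 0 \<and> A $ Inl 1 = B $ Inl 1 \<and> A $ Inl 2 = B $ Inl 2 \<and>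
     offdiag A 0 = offdiag B 0 \<and> offdiag A 1 = offdiag B 1 \<and> offdiag A 2 = offdiag B 2"
  (is "_ \<longleftrightarrow> ?R")
proof
  assume ?R
  then have "\<forall>i. A $ Inl i = B $ Inl i" "\<forall>i. offdiag A i = offdiag B i"
    unfolding forall_3_0 by blast+
  then show "A = B" by (intro albert_eqI) blast+
qed simp

text \<open>
The element with diagonal \<open>a\<close> and off-diagonal octonions \<open>x\<close>; reading it off by \<open>$ Inl i\<close> and \<open>offdiag\<close>
avoids the sum type of the coordinates.
\<close>

definition albert_vec :: "(3 \<Rightarrow> 'a) \<Rightarrow> (3 \<Rightarrow> 'a oct) \<Rightarrow> 'a albert" where
  "albert_vec a x = (\<chi> c. case c of Inl i \<Rightarrow> a i | Inr (i, k) \<Rightarrow> x i $ k)"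

lemma albert_vec_nth [simp]: "albert_vec a x $ Inl i = a i" "offdiag (albert_vec a x) i = x i"
  by (simp_all add: albert_vec_def offdiag_def)

definition albert_one :: "'a::comm_ring_1 albert" where
  "albert_one = albert_vec (\<lambda>_. 1) (\<lambda>_. 0)"

lemma albert_one_nth [simp]: "albert_one $ Inl i = 1" "offdiag albert_one i = 0"
  by (simp_all add: albert_one_def)

text \<open>
The Freudenthal product, normalised so that \<open>cross A A\<close> is twice the adjoint (the matrix of \<open>2 \<times> 2\<close>
minors) of \<open>A\<close>.  It vanishes exactly for \<open>A\<close> of rank at most one.
\<close>

definition cross :: "'a::comm_ring_1 albert \<Rightarrow> 'a albert \<Rightarrow> 'a albert" where
  "cross A B = albert_vec
     (\<lambda>i. A $ Inl (i+1) * B $ Inl (i+2) + A $ Inl (i+2) * B $ Inl (i+1) - 2 * oct_inner (offdiag A i) (offdiag B i))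
     (\<lambda>i. oct_cnj (oct_mult (offdiag A (i+1)) (offdiag B (i+2)) + oct_mult (offdiag B (i+1)) (offdiag A (i+2)))
        - A $ Inl i *s offdiag B i - B $ Inl i *s offdiag A i)"

definition trace_form :: "'a::comm_ring_1 albert \<Rightarrow> 'a albert \<Rightarrow> 'a" where
  "trace_form A B = (\<Sum>i\<in>UNIV. A $ Inl i * B $ Inl i + 2 * oct_inner (offdiag A i) (offdiag B i))"

definition cubic_polar :: "'a::comm_ring_1 albert \<Rightarrow> 'a albert \<Rightarrow> 'a albert \<Rightarrow> 'a" where
  "cubic_polar A B C = trace_form (cross A B) C"

lemma cross_nth:
  "cross A B $ Inl i = A $ Inl (i+1) * B $ Inl (i+2) + A $ Inl (i+2) * B $ Inl (i+1)
     - 2 * oct_inner (offdiag A i) (offdiag B i)"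
  "offdiag (cross A B) i = oct_cnj (oct_mult (offdiag A (i+1)) (offdiag B (i+2))
       + oct_mult (offdiag B (i+1)) (offdiag A (i+2)))
     - A $ Inl i *s offdiag B i - B $ Inl i *s offdiag A i"
  by (simp_all add: cross_def)

lemma cross_commute: "cross A B = cross B A"
  by (rule albert_eqI) (simp_all add: cross_nth oct_inner_commute algebra_simps)

lemma cross_linear:
  "cross (A + B) C = cross A C + cross B C" "cross (c *s A) C = c *s cross A C"
  by (rule albert_eqI; simp add: cross_nth oct_cnj_add oct_cnj_scale algebra_simps
    vec.scale_right_distrib vec.scale_left_distrib vec.scale_right_diff_distrib)+

lemma trace_form_commute: "trace_form A B = trace_form B A"
  by (simp add: trace_form_def oct_inner_commute mult.commute)

lemma trace_form_linear [simp]: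
  "trace_form (A + B) C = trace_form A C + trace_form B C"
  "trace_form C (A + B) = trace_form C A + trace_form C B"
  "trace_form (A - B) C = trace_form A C - trace_form B C"
  "trace_form C (A - B) = trace_form C A - trace_form C B"
  "trace_form (c *s A) C = c * trace_form A C"
  "trace_form C (c *s A) = c * trace_form C A"
  "trace_form 0 C = 0" "trace_form C 0 = 0"
  by (simp_all add: trace_form_def sum_3_0 algebra_simps)

lemma trace_form_axis:
  "trace_form A (axis (Inl i) 1) = A $ Inl i"
  "trace_form A (axis (Inr (i, k)) 1) = 2 * A $ Inr (i, k)"
  using exhaust_3_0[of i]
  by (auto simp: trace_form_def sum_3_0 axis_nth_if offdiag_nth)

lemma trace_form_nondegenerate:
  fixes A :: "'a::field_char_0 albert"
  assumes "\<And>B. trace_form A B = 0"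
  shows "A = 0"
proof -
  have "A $ c = 0" for c
    using assms[of "axis c 1"] by (cases c) (auto simp: trace_form_axis)
  then show ?thesis by (simp add: vec_eq_iff)
qed

lemma cubic_polar_commute: "cubic_polar A B C = cubic_polar B A C"
  by (simp add: cubic_polar_def cross_commute)

text \<open>
Each of the summands \<open>a\<^sub>0 b\<^sub>1 c\<^sub>2\<close>, \<open>a\<^sub>i \<langle>y\<^sub>i, z\<^sub>i\<rangle>\<close> and \<open>Re (x\<^sub>i y\<^sub>j z\<^sub>k)\<close> of the trilinear form occurs with
all its permutations; for the last kind this is the cyclic invariance of the real part.
\<close>

lemma cubic_polar_rotate: "cubic_polar A B C = cubic_polar B C A"
proof -
  have r: "oct_mult (oct_mult x y) z $ 0 = oct_mult (oct_mult y z) x $ 0" for x y z :: "'a oct"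
    by (rule oct_trilinear_cyclic)
  show ?thesis
    by (simp add: cubic_polar_def trace_form_def cross_nth sum_3_0 mod_3 oct_cnj_add
      oct_inner_cnj_mult algebra_simps oct_inner_commute[of "offdiag C _"] oct_inner_commute[of "offdiag B _" "offdiag A _"]
      r[of _ "offdiag A _" "offdiag B _"] r[of _ "offdiag A _" "offdiag C _"]
     r[of "offdiag A _" "offdiag B _"] r[of "offdiag A _" "offdiag C _"])
qed

lemma cubic_polar_linear [simp]:
  "cubic_polar (A + B) C D = cubic_polar A C D + cubic_polar B C D"
  "cubic_polar C (A + B) D = cubic_polar C A D + cubic_polar C B D"
  "cubic_polar C D (A + B) = cubic_polar C D A + cubic_polar C D B"
  "cubic_polar (c *s A) C D = c * cubic_polar A C D"
  "cubic_polar C (c *s A) D = c * cubic_polar C A D"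
  "cubic_polar C D (c *s A) = c * cubic_polar C D A"
  by (simp_all add: cubic_polar_def cross_linear cross_commute[of C])

lemma cross_self_nth:
  "cross A A $ Inl i = 2 * (A $ Inl (i+1) * A $ Inl (i+2) - oct_norm (offdiag A i))"
  "offdiag (cross A A) i = 2 *s (oct_cnj (oct_mult (offdiag A (i+1)) (offdiag A (i+2)))
     - A $ Inl i *s offdiag A i)"
  by (simp_all add: cross_nth oct_inner_self vec_eq_iff oct_cnj_def algebra_simps)

lemma albert_det_cubic_polar:
  "albert_det A = cubic_polar A A A / 6" for A :: "'a::field_char_0 albert"
proof -
  have r: "oct_mult (oct_mult x y) z $ 0 = oct_mult (oct_mult y z) x $ 0" for x y z :: "'a oct"
    by (rule oct_trilinear_cyclic)
  show ?thesis unfolding albert_det_explicit cubic_polar_def trace_form_def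
    by (simp add: cross_self_nth sum_3_0 mod_3 oct_inner_cnj_mult oct_inner_self field_simps
      r[of "offdiag A 2" "offdiag A 0"]  r[of "offdiag A 1" "offdiag A 2"])
qed

lemma cubic_polar_swap: "cubic_polar A B C = cubic_polar A C B"
  by (metis cubic_polar_commute cubic_polar_rotate)

text \<open>
The products with the three diagonal idempotents show all the entries of \<open>A\<close>.
\<close>

lemma cross_axis_separates:
  fixes A :: "'a::field_char_0 albert"
  assumes "\<And>i. cross A (axis (Inl i) 1) = 0"
  shows "A = 0"
proof (rule albert_eqI)
  show "A $ Inl i = 0 $ Inl i" for i
    using arg_cong[OF assms[of "i + 1"], of "\<lambda>A. A $ Inl (i + 2)"] exhaust_3_0[of i]
    by (auto simp: cross_nth axis_nth_if mod_3)
  show "offdiag A i = offdiag 0 i" for i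
    using arg_cong[OF assms[of i], of "\<lambda>A. offdiag A i"]
    by (simp add: cross_nth axis_nth_if)
qed

lemma cubic_polar_nondegenerate:
  fixes A :: "'a::field_char_0 albert"
  assumes "\<And>B C. cubic_polar A B C = 0"
  shows "A = 0"
proof (rule cross_axis_separates)
  show "cross A (axis (Inl i) 1) = 0" for i
    using assms by (intro trace_form_nondegenerate) (simp add: cubic_polar_def)
qed

lemma cross_idempotent_axis: "cross (axis (Inl i) 1) (axis (Inl i) 1) = (0 :: 'a::comm_ring_1 albert)"
proof (rule albert_eqI)
  show "cross (axis (Inl i) 1) (axis (Inl i) 1) $ Inl j = (0 :: 'a albert) $ Inl j" for j
    using exhaust_3_0[of j] by (auto simp: cross_self_nth axis_nth_if mod_3 oct_norm_def)
qed (simp add: cross_self_nth)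

text \<open>
The trilinear form is determined by the cubic form, and hence it is preserved by every linear map
that preserves the determinant.
\<close>

lemma cubic_polar_det:
  "cubic_polar A B C = albert_det (A + B + C) - albert_det (A + B) - albert_det (A + C)
     - albert_det (B + C) + albert_det A + albert_det B + albert_det C"
  for A :: "'a::field_char_0 albert"
proof -
  note sym = cubic_polar_commute[of C A] cubic_polar_commute[of B A] cubic_polar_commute[of C B]
     cubic_polar_swap[of _ B A] cubic_polar_swap[of _ C A] cubic_polar_swap[of _ C B]
  have "6 * cubic_polar A B C = cubic_polar (A+B+C) (A+B+C) (A+B+C) - cubic_polar (A+B) (A+B) (A+B)
    - cubic_polar (A+C) (A+C) (A+C) - cubic_polar (B+C) (B+C) (B+C)
    + cubic_polar A A A + cubic_polar B B B + cubic_polar C C C"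
    by (simp add: sym)
  then have "cubic_polar A B C = (cubic_polar (A+B+C) (A+B+C) (A+B+C) - cubic_polar (A+B) (A+B) (A+B)
    - cubic_polar (A+C) (A+C) (A+C) - cubic_polar (B+C) (B+C) (B+C)
    + cubic_polar A A A + cubic_polar B B B + cubic_polar C C C) / 6"
    by (simp del: cubic_polar_linear add: eq_divide_eq mult.commute)
  then show ?thesis
    by (simp only: albert_det_cubic_polar diff_divide_distrib add_divide_distrib)
qed

lemma albert_det_one: "albert_det (albert_one :: 'a::field_char_0 albert) = 1"
  by (simp add: albert_det_explicit oct_norm_def)

text \<open>
The cyclic symmetry of the determinant lets an elementary transformation at any position be
treated as if it were at the first.
\<close>

lemma albert_det_at:
  fixes A :: "'a::field_char_0 albert"
  shows "albert_det A = A $ Inl i * A $ Inl (i+1) * A $ Inl (i+2)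
    - A $ Inl i * oct_norm (offdiag A i) - A $ Inl (i+1) * oct_norm (offdiag A (i+1))
    - A $ Inl (i+2) * oct_norm (offdiag A (i+2))
    + 2 * oct_mult (oct_mult (offdiag A i) (offdiag A (i+1))) (offdiag A (i+2)) $ 0"
proof -
  have "oct_mult (oct_mult (offdiag A 0) (offdiag A 1)) (offdiag A 2) $ 0
    = oct_mult (oct_mult (offdiag A i) (offdiag A (i+1))) (offdiag A (i+2)) $ 0"
    using exhaust_3_0[of i] by (auto simp: mod_3) (metis oct_trilinear_cyclic)+
  moreover have "A $ Inl 0 * A $ Inl 1 * A $ Inl 2 = A $ Inl i * A $ Inl (i+1) * A $ Inl (i+2)"
    using exhaust_3_0[of i] by (auto simp: mod_3)
  ultimately show ?thesis
    unfolding albert_det_explicit by (simp add: sum_3_shift[of _ i])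
qed


section \<open>Recovering the Jordan product\<close>

lemma cubic_polar_one:
  "cubic_polar albert_one A B = albert_trace A * albert_trace B - trace_form A B"
  by (simp add: cubic_polar_def trace_form_def cross_nth sum_3_0 mod_3 albert_trace_def algebra_simps)

lemma trace_form_one: "trace_form A albert_one = albert_trace A"
  by (simp add: trace_form_def albert_trace_def)

lemma albert_trace_one: "albert_trace (albert_one :: 'a::comm_ring_1 albert) = 3"
  by (simp add: albert_trace_def)

text \<open>
The polarised Cayley-Hamilton identity \<open>A\<^sup>2 = A\<^sup># + tr(A) A - s(A) 1\<close>, where \<open>s\<close> is the second
elementary symmetric function.
\<close>

lemma jordan_cross:
  fixes A B :: "'a::field_char_0 albert"
  shows "A \<star> B = (1 / 2) *s (cross A B + albert_trace A *s B + albert_trace B *s A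
     - (albert_trace A * albert_trace B - trace_form A B) *s albert_one)"
proof (rule albert_eqI)
  fix i :: 3
  have t: "albert_trace A = A $ Inl i + A $ Inl (i+1) + A $ Inl (i+2)" for A :: "'a albert"
    by (simp add: albert_trace_def sum_3_shift[of _ i])
  have "2 * (A \<star> B) $ Inl i = (cross A B + albert_trace A *s B + albert_trace B *s A
     - (albert_trace A * albert_trace B - trace_form A B) *s albert_one) $ Inl i"
    unfolding jordan_diag oct_inner_def[symmetric] t trace_form_def sum_3_shift[of _ i]
    by (simp add: cross_nth algebra_simps)
  then show "(A \<star> B) $ Inl i = ((1 / 2) *s (cross A B + albert_trace A *s B + albert_trace B *s A
     - (albert_trace A * albert_trace B - trace_form A B) *s albert_one)) $ Inl i"
    unfolding vector_smult_component by (simp add: eq_divide_eq mult.commute)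
  show "offdiag (A \<star> B) i = offdiag ((1 / 2) *s (cross A B + albert_trace A *s B + albert_trace B *s A
     - (albert_trace A * albert_trace B - trace_form A B) *s albert_one)) i"
    unfolding offdiag_jordan t offdiag_linear
    by (rule arg_cong[where f = "\<lambda>x. (1 / 2) *s x"]) (simp add: cross_nth vec_eq_iff algebra_simps)
qed

lemma albert_trace_linear:
  "albert_trace (A + B) = albert_trace A + albert_trace B"
  "albert_trace (c *s A) = c * albert_trace A" for A :: "'a::comm_ring_1 albert"
  by (simp_all add: albert_trace_def sum.distrib sum_distrib_left)

lemma albert_trace_zero [simp]: "albert_trace 0 = 0"
  by (simp add: albert_trace_def)

lemma jordan_self:
  fixes A :: "'a::field_char_0 albert"
  shows "A \<star> A = (1 / 2) *s cross A A + albert_trace A *s A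
    - (albert_trace (cross A A) / 2) *s albert_one"
proof -
  have "albert_trace A * albert_trace A - trace_form A A = cubic_polar A A albert_one"
    by (subst cubic_polar_rotate[symmetric]) (simp only: cubic_polar_one)
  then have c: "albert_trace A * albert_trace A - trace_form A A = albert_trace (cross A A)"
    by (simp only: cubic_polar_def trace_form_one)
  show ?thesis
    unfolding jordan_cross c by (simp add: vec_eq_iff field_simps)
qed

text \<open>
For trace 1, the Cayley-Hamilton identity says that \<open>P\<^sup>2 - P\<close> is \<open>P\<^sup># - tr(P\<^sup>#) 1\<close>.  Taking traces, this
vanishes only if \<open>tr(P\<^sup>#) = 3 tr(P\<^sup>#)\<close>.
\<close>

lemma OP2_iff:
  fixes P :: "'a::field_char_0 albert"
  shows "P \<in> OP2 \<longleftrightarrow> cross P P = 0 \<and> albert_trace P = 1"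
proof -
  show ?thesis
  proof
    assume P: "P \<in> OP2"
    then have t: "albert_trace P = 1" and PP: "P \<star> P = P" by (auto simp: OP2_def)
    have x: "cross P P = albert_trace (cross P P) *s albert_one"
      using PP unfolding jordan_self t by (simp add: vec_eq_iff field_simps)
    have "albert_trace (cross P P) = albert_trace (cross P P) * 3"
      using arg_cong[OF x, of albert_trace] by (simp only: albert_trace_linear albert_trace_one)
    then have "albert_trace (cross P P) = 0"
      by simp
    with x t show "cross P P = 0 \<and> albert_trace P = 1" by simp
  next
    assume P: "cross P P = 0 \<and> albert_trace P = 1"
    then show "P \<in> OP2" by (simp add: OP2_def jordan_self)
  qed
qed


section \<open>Linear maps that preserve the determinant\<close>

lemma linear_vecD:
  assumes "Vector_Spaces.linear (*s) (*s) g"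
  shows "g (x + y) = g x + g y" "g (c *s x) = c *s g x" "g 0 = 0"
proof -
  interpret l: Vector_Spaces.linear "(*s)" "(*s)" g by fact
  show "g (x + y) = g x + g y" "g (c *s x) = c *s g x" "g 0 = 0"
    by (simp_all add: l.add l.scale l.zero)
qed

lemma linear_vecI:
  assumes "\<And>x y. g (x + y) = g x + g y" "\<And>c x. g (c *s x) = c *s g x"
  shows "Vector_Spaces.linear (*s) (*s) g"
  by unfold_locales (simp_all add: assms)

lemma linear_formI:
  assumes "\<And>x y. f (x + y) = f x + f y" "\<And>c x. f (c *s x) = c * f x"
  shows "Vector_Spaces.linear (*s) (*) f"
  by unfold_locales (simp_all add: assms algebra_simps)

lemma linear_formD:
  assumes "Vector_Spaces.linear (*s) (*) f"
  shows "f (x + y) = f x + f y" "f (c *s x) = c * f x" "f 0 = 0"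
proof -
  interpret l: Vector_Spaces.linear "(*s)" "(*)" f by fact
  show "f (x + y) = f x + f y" "f (c *s x) = c * f x" "f 0 = 0"
    by (simp_all add: l.add l.scale l.zero)
qed

lemma cubic_polar_invariant:
  assumes "Vector_Spaces.linear (*s) (*s) g" "\<And>A :: complex albert. albert_det (g A) = albert_det A"
  shows "cubic_polar (g A) (g B) (g C) = cubic_polar A B C"
  by (simp only: cubic_polar_det assms(2) flip: linear_vecD(1)[OF assms(1)])

text \<open>
Bijectivity is automatic: an element of the kernel is orthogonal to everything under the
nondegenerate trilinear form.
\<close>

lemma E6_iff:
  "g \<in> E6 \<longleftrightarrow> Vector_Spaces.linear (*s) (*s) g \<and> (\<forall>A. albert_det (g A) = albert_det A)"
proof -
  have "bij g" if l: "Vector_Spaces.linear (*s) (*s) g" and d: "\<And>A :: complex albert. albert_det (g A) = albert_det A"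
  proof -
    have "A = 0" if "g A = 0" for A
    proof (rule cubic_polar_nondegenerate)
      fix B C
      have "cubic_polar A B C = cubic_polar 0 (g B) (g C)"
        by (metis that cubic_polar_invariant[OF l d])
      also have "\<dots> = 0"
        using cubic_polar_linear(4)[of 0 0 "g B" "g C"] by simp
      finally show "cubic_polar A B C = 0" .
    qed
    note zero = this
    have "inj g"
    proof (rule injI)
      fix A B assume "g A = g B"
      then have "g (A + (- 1) *s B) = 0"
        by (simp only: linear_vecD[OF l]) simp
      then show "A = B" using zero by fastforce
    qed
    then show ?thesis
      using vec.linear_injective_imp_surjective[OF l] by (simp add: bij_def)
  qed
  then show ?thesis by (auto simp: E6_def)
qed

lemma E6_simps:
  assumes "g \<in> E6"
  shows "g (x + y) = g x + g y" "g (c *s x) = c *s g x" "g 0 = 0"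
    and E6_cubic_polar: "cubic_polar (g A) (g B) (g C) = cubic_polar A B C"
    and E6_det: "albert_det (g A) = albert_det A"
    and E6_bij: "bij g"
    and E6_linear: "Vector_Spaces.linear (*s) (*s) g"
  using assms linear_vecD[of g] cubic_polar_invariant[of g]
  by (auto simp: E6_def)

lemma E6_comp:
  assumes "g \<in> E6" "h \<in> E6"
  shows "g \<circ> h \<in> E6"
  using assms by (auto simp: E6_iff linear_vecD intro!: linear_vecI)

lemma E6_inv_cancel:
  assumes "g \<in> E6"
  shows "g (inv g A) = A" "inv g (g A) = A"
  using E6_bij[OF assms] by (simp_all add: bij_is_surj surj_f_inv_f bij_is_inj)

lemma E6_inv:
  assumes "g \<in> E6"
  shows "inv g \<in> E6"
  unfolding E6_iff
proof (intro conjI allI linear_vecI)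
  show "inv g (A + B) = inv g A + inv g B" for A B
    by (metis E6_inv_cancel[OF assms] E6_simps(1)[OF assms])
  show "inv g (c *s A) = c *s inv g A" for A c
    by (metis E6_inv_cancel[OF assms] E6_simps(2)[OF assms])
  show "albert_det (inv g A) = albert_det A" for A
    by (metis E6_inv_cancel[OF assms] E6_det[OF assms])
qed

text \<open>
The product itself is not equivariant, since it takes values in the dual representation, but its
vanishing is the vanishing of an invariant linear form.
\<close>

lemma E6_cross_eq_0_iff:
  assumes g: "g \<in> E6"
  shows "cross (g A) (g B) = 0 \<longleftrightarrow> cross A B = 0"
proof -
  have iff: "cross A B = 0 \<longleftrightarrow> (\<forall>C. cubic_polar A B C = 0)" for A B :: "complex albert"
    unfolding cubic_polar_def using trace_form_nondegenerate by auto
  have "(\<forall>C. cubic_polar (g A) (g B) C = 0) \<longleftrightarrow> (\<forall>C. cubic_polar (g A) (g B) (g C) = 0)"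
    by (metis E6_inv_cancel(1)[OF g])
  then show ?thesis
    by (simp only: iff E6_cubic_polar[OF g])
qed

lemma E6_eq_0_iff:
  assumes g: "g \<in> E6"
  shows "g v = 0 \<longleftrightarrow> v = 0"
proof
  assume "g v = 0"
  then have "inv g (g v) = inv g (g 0)" by (simp only: E6_simps(3)[OF g])
  then show "v = 0" by (simp only: E6_inv_cancel(2)[OF g])
qed (simp only: E6_simps(3)[OF g])

text \<open>
Polarising the determinant at the identity gives \<open>N(1, 1, A) = 2 tr A\<close> and
\<open>N(1, A, B) = tr A tr B - T(A, B)\<close>.  So a map in \<open>E\<^sub>6\<close> that fixes the identity preserves the trace and the
trace form, hence also \<open>A \<times> B\<close>, and the Jordan product is built from these.
\<close>

lemma F4I:
  assumes g: "g \<in> E6" and one: "g albert_one = albert_one"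
  shows "g \<in> F4"
proof -
  have c1: "cubic_polar albert_one (g A) (g B) = cubic_polar albert_one A B" for A B
    using E6_cubic_polar[OF g, of albert_one A B] by (simp only: one)
  have "2 * albert_trace A = cubic_polar albert_one A albert_one" for A :: "complex albert"
    by (simp add: cubic_polar_one albert_trace_one trace_form_one)
  then have tr: "albert_trace (g A) = albert_trace A" for A
    by (metis c1 mult_cancel_left one zero_neq_numeral)
  have tf: "trace_form (g A) (g B) = trace_form A B" for A B
    using c1[of A B] by (simp add: cubic_polar_one tr)
  have cr: "cross (g A) (g B) = g (cross A B)" for A B
  proof -
    have "trace_form (cross (g A) (g B) - g (cross A B)) (g C) = 0" for C
      using E6_cubic_polar[OF g, of A B C] by (simp add: cubic_polar_def tf)
    then have "trace_form (cross (g A) (g B) - g (cross A B)) C = 0" for C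
      by (metis E6_inv_cancel(1)[OF g])
    then have "cross (g A) (g B) - g (cross A B) = 0"
      by (rule trace_form_nondegenerate)
    then show ?thesis by simp
  qed
  have diff: "g (A - B) = g A - g B" for A B
    using E6_simps(1)[OF g, of "A - B" B] by simp
  have "g (A \<star> B) = g A \<star> g B" for A B
    by (simp only: jordan_cross cr tf tr diff E6_simps[OF g] one)
  then show ?thesis using g by (simp add: F4_def)
qed


section \<open>Extremal weight vectors have rank one\<close>

lemma linear_form_vanishes:
  assumes "Vector_Spaces.linear (*s) (*) f" "vec.span S = UNIV" "\<And>x. x \<in> S \<Longrightarrow> f x = 0"
  shows "f x = (0::complex)"
proof -
  have "x \<in> vec.span S" using assms(2) by simp
  then show ?thesis
    by (induction rule: vec.span_induct_alt) (auto simp: linear_formD[OF assms(1)] assms(3))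
qed

text \<open>
Weights can be compared at the single parameter \<open>t = 2\<close>, where the map \<open>k \<mapsto> 2\<^sup>k\<close> is injective.
\<close>

lemma cubic_polar_weight:
  assumes \<rho>: "one_parameter_subgroup \<rho>"
    and "A \<in> weight_space \<rho> i" "B \<in> weight_space \<rho> j" "C \<in> weight_space \<rho> k"
    and "cubic_polar A B C \<noteq> 0"
  shows "i + j + k = 0"
proof -
  have "\<rho> 2 \<in> E6" using \<rho> by (simp add: one_parameter_subgroup_def)
  from E6_cubic_polar[OF this, of A B C] have "cubic_polar (2 powi i *s A) (2 powi j *s B) (2 powi k *s C) = cubic_polar A B C"
    using assms(2-4) by (simp add: weight_space_def)
  then have "2 powi i * (2 powi j * (2 powi k)) * cubic_polar A B C = cubic_polar A B C"
    by (simp add: mult_ac)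
  then have "2 powi i * (2 powi j * (2 powi k)) = (1::complex)"
    using assms(5) by simp
  then have "(2::complex) powi (i + j + k) = 1"
    by (simp add: power_int_add mult.assoc)
  then have "norm ((2::complex) powi (i + j + k)) = 1" by simp
  then have "(2::real) powi (i + j + k) = 2 powi 0" by (simp add: norm_power_int)
  then show ?thesis
    using power_int_strict_increasing[of "i + j + k" 0 "2::real"]
      power_int_strict_increasing[of 0 "i + j + k" "2::real"]
    by (cases "i + j + k < 0"; cases "0 < i + j + k") auto
qed

text \<open>
If \<open>v \<times> v \<noteq> 0\<close>, then the weight argument produces an \<open>h \<noteq> 0\<close> for which the bilinear form
\<open>N(h, _, _)\<close> has rank at most one.  A symmetric form of rank one for which \<open>E\<close> is isotropic has \<open>E\<close> in its
radical, so that \<open>h \<times> E = 0\<close> for each diagonal idempotent \<open>E\<close>, and this means \<open>h = 0\<close>.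
\<close>

lemma extremal_imp_cross_eq_0:
  assumes "extremal_weight_vector v"
  shows "cross v v = 0"
proof (rule ccontr)
  assume nz: "cross v v \<noteq> 0"
  obtain \<rho> m where \<rho>: "one_parameter_subgroup \<rho>" and m: "weight_space \<rho> m = vec.span {v}"
    and below: "\<And>k. k < m \<Longrightarrow> weight_space \<rho> k = {0}"
    using assms by (auto simp: extremal_weight_vector_def)
  have span: "vec.span (\<Union>k. weight_space \<rho> k) = UNIV"
    using \<rho> by (simp add: one_parameter_subgroup_def)
  have v: "v \<in> weight_space \<rho> m"
    by (simp add: m vec.span_base)
  have lin: "Vector_Spaces.linear (*s) (*) (cubic_polar A B)" for A B :: "complex albert"
    by (rule linear_formI) simp_all
  obtain k h where h: "h \<in> weight_space \<rho> k" and vvh: "cubic_polar v v h \<noteq> 0"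
  proof (rule ccontr)
    assume *: "\<not> thesis"
    have "cubic_polar v v B = 0" for B
      by (rule linear_form_vanishes[OF lin span]) (use * that in blast)
    then show False
      using nz trace_form_nondegenerate[of "cross v v"] by (auto simp: cubic_polar_def)
  qed
  have k: "k = - 2 * m"
    using cubic_polar_weight[OF \<rho> v v h vvh] by simp
  have vanish: "cubic_polar h A B = 0"
    if A: "A \<in> weight_space \<rho> i" and B: "B \<in> weight_space \<rho> j" and "i \<noteq> m \<or> j \<noteq> m" for A B i j
  proof (cases "i < m \<or> j < m")
    case True
    then have "A = 0 \<or> B = 0" using below A B by auto
    then show ?thesis
      using linear_formD(3)[OF lin] by (auto simp: cubic_polar_swap[of _ 0])
  next
    case False
    then show ?thesis
      using cubic_polar_weight[OF \<rho> h A B] that(3) k by fastforce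
  qed
  \<comment> \<open>Every row of the bilinear form \<open>N(h, _, _)\<close> is a multiple of the row of \<open>v\<close>.\<close>
  have rank1: "\<exists>c. \<forall>B. cubic_polar h A B = c * cubic_polar h v B" for A
  proof -
    have "A \<in> vec.span (\<Union>k. weight_space \<rho> k)" using span by simp
    then show ?thesis
    proof (induction rule: vec.span_induct_alt)
      case base
      have "cubic_polar h 0 B = 0 * cubic_polar h v B" for B
        using linear_formD(3)[OF lin] by (simp add: cubic_polar_swap[of _ 0])
      then show ?case by blast
    next
      case (step a A A')
      then obtain i where A: "A \<in> weight_space \<rho> i" by auto
      obtain c' where c': "\<And>B. cubic_polar h A' B = c' * cubic_polar h v B"
        using step by blast
      obtain c where c: "\<And>B. cubic_polar h A B = c * cubic_polar h v B"
      proof (cases "i = m")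
        case True
        then obtain c where "A = c *s v"
          using A m by (auto simp: vec.span_singleton)
        then show ?thesis using that[of c] by simp
      next
        case False
        have "cubic_polar h A B = 0" for B
          by (rule linear_form_vanishes[OF lin span]) (use False vanish A in blast)
        then show ?thesis using that[of 0] by simp
      qed
      have "cubic_polar h (a *s A + A') B = (a * c + c') * cubic_polar h v B" for B
        by (simp add: c c' algebra_simps)
      then show ?case by blast
    qed
  qed
  have "cross h (axis (Inl i) 1) = 0" for i
  proof (rule trace_form_nondegenerate)
    fix B
    let ?e = "axis (Inl i) 1 :: complex albert"
    obtain c where c: "\<And>B. cubic_polar h ?e B = c * cubic_polar h v B"
      using rank1 by blast
    obtain d where d: "\<And>C. cubic_polar h B C = d * cubic_polar h v C"
      using rank1 by blast
    have "cubic_polar h ?e ?e = trace_form (cross ?e ?e) h"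
      unfolding cubic_polar_rotate[of h] by (simp add: cubic_polar_def)
    then have "c * cubic_polar h v ?e = 0"
      using c[of ?e] by (simp add: cross_idempotent_axis)
    moreover have "cubic_polar h ?e B = d * cubic_polar h v ?e"
      by (subst cubic_polar_swap) (rule d)
    ultimately show "trace_form (cross h ?e) B = 0"
      using c[of B] by (auto simp flip: cubic_polar_def)
  qed
  then have "h = 0"
    by (rule cross_axis_separates)
  then show False
    using vvh linear_formD(3)[OF lin] by simp
qed


section \<open>Elementary transformations\<close>

lemma index_3_distinct [simp]: "i + 1 \<noteq> i" "i + 2 \<noteq> i" "i + 2 \<noteq> i + 1"
  "i \<noteq> i + 1" "i \<noteq> i + 2" "i + 1 \<noteq> i + 2" for i :: 3
  using exhaust_3_0[of i] by auto

text \<open>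
The map \<open>A \<mapsto> T A T\<^sup>*\<close> for \<open>T = 1 + y E\<close> with the matrix unit \<open>E\<close> at position \<open>(i + 1, i + 2)\<close>: the row
\<open>i + 2\<close> is multiplied by \<open>y\<close> and added to the row \<open>i + 1\<close>, and likewise for the columns.  No entry
involves a product of three octonions none of which is a scalar, so no bracketing has to be chosen.
\<close>

definition row_add :: "3 \<Rightarrow> 'a oct \<Rightarrow> 'a::comm_ring_1 albert \<Rightarrow> 'a albert" where
  "row_add i y A = albert_vec
     ((($) A \<circ> Inl)(i+1 := A $ Inl (i+1) + 2 * oct_inner y (offdiag A i) + oct_norm y * A $ Inl (i+2)))
     ((offdiag A)(i := offdiag A i + A $ Inl (i+2) *s y,
        i+2 := offdiag A (i+2) + oct_cnj (oct_mult y (offdiag A (i+1)))))"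

text \<open>
The opposite row operation, with \<open>T = 1 + y\<^sup>* E\<close> and \<open>E\<close> at position \<open>(i + 2, i + 1)\<close>.  Conjugating \<open>y\<close> makes
the octonion at position \<open>(i + 1, i + 2)\<close> change by a multiple of \<open>y\<close> for both operations.
\<close>

definition row_add' :: "3 \<Rightarrow> 'a oct \<Rightarrow> 'a::comm_ring_1 albert \<Rightarrow> 'a albert" where
  "row_add' i y A = albert_vec
     ((($) A \<circ> Inl)(i+2 := A $ Inl (i+2) + 2 * oct_inner y (offdiag A i) + oct_norm y * A $ Inl (i+1)))
     ((offdiag A)(i := offdiag A i + A $ Inl (i+1) *s y,
        i+1 := offdiag A (i+1) + oct_cnj (oct_mult (offdiag A (i+2)) y)))"

lemma row_add_nth:
  "row_add i y A $ Inl j = (if j = i + 1 then A $ Inl (i+1) + 2 * oct_inner y (offdiag A i) + oct_norm y * A $ Inl (i+2) else A $ Inl j)"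
  "offdiag (row_add i y A) j = (if j = i then offdiag A i + A $ Inl (i+2) *s y
     else if j = i + 2 then offdiag A (i+2) + oct_cnj (oct_mult y (offdiag A (i+1))) else offdiag A j)"
  by (simp_all add: row_add_def)

lemma row_add'_nth:
  "row_add' i y A $ Inl j = (if j = i + 2 then A $ Inl (i+2) + 2 * oct_inner y (offdiag A i) + oct_norm y * A $ Inl (i+1) else A $ Inl j)"
  "offdiag (row_add' i y A) j = (if j = i then offdiag A i + A $ Inl (i+1) *s y
     else if j = i + 1 then offdiag A (i+1) + oct_cnj (oct_mult (offdiag A (i+2)) y) else offdiag A j)"
  by (simp_all add: row_add'_def)

text \<open>
The terms that are linear in \<open>y\<close> cancel by the composition law \<open>\<langle>x u, y u\<rangle> = \<langle>x, y\<rangle> N(u)\<close> and the cyclic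
invariance of the real part; those that are quadratic in \<open>y\<close> cancel by \<open>N(y u) = N(y) N(u)\<close>.
\<close>

lemma albert_det_row_add: "albert_det (row_add i y A) = albert_det (A :: 'a::field_char_0 albert)"
proof -
  obtain j k where jk: "i + 1 = j" "i + 2 = k" by simp
  then have ne: "j \<noteq> i" "k \<noteq> i" "k \<noteq> j" by auto
  let ?x = "offdiag A i" and ?u = "offdiag A j" and ?w = "offdiag A k"
  have c: "oct_mult (oct_mult ?x ?u) (oct_cnj (oct_mult y ?u)) $ 0 = oct_inner ?x y * oct_norm ?u"
    "oct_mult (oct_mult y ?u) (oct_cnj (oct_mult y ?u)) $ 0 = oct_norm y * oct_norm ?u"
    by (simp_all add: oct_mult_cnj_nth_0 oct_inner_mult_cancel oct_inner_self oct_norm_mult flip: oct_inner_def)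
  have n: "oct_norm (oct_mult y ?u) = oct_norm y * oct_norm ?u"
    by (rule oct_norm_mult)
  show ?thesis
    unfolding albert_det_at[of _ i] jk
    by (simp add: row_add_nth[of i y A, unfolded jk] ne ne[symmetric] oct_norm_add oct_norm_scale oct_inner_cnj_mult c n
      oct_inner_commute[of y] power2_eq_square algebra_simps)
qed

lemma albert_det_row_add': "albert_det (row_add' i y A) = albert_det (A :: 'a::field_char_0 albert)"
proof -
  obtain j k where jk: "i + 1 = j" "i + 2 = k" by simp
  then have ne: "j \<noteq> i" "k \<noteq> i" "k \<noteq> j" by auto
  let ?x = "offdiag A i" and ?u = "offdiag A j" and ?w = "offdiag A k"
  have r: "oct_mult (oct_mult a b) c $ 0 = oct_mult (oct_mult c a) b $ 0" for a b c :: "'a oct"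
    by (rule oct_trilinear_cyclic[symmetric])
  have c: "oct_mult (oct_mult ?w ?x) (oct_cnj (oct_mult ?w y)) $ 0 = oct_inner ?x y * oct_norm ?w"
    "oct_mult (oct_mult ?w y) (oct_cnj (oct_mult ?w y)) $ 0 = oct_norm y * oct_norm ?w"
    by (simp_all add: oct_mult_cnj_nth_0 oct_inner_mult_cancel oct_inner_self oct_norm_mult flip: oct_inner_def)
  have n: "oct_norm (oct_mult ?w y) = oct_norm ?w * oct_norm y"
    by (rule oct_norm_mult)
  show ?thesis
    unfolding albert_det_at[of _ i] jk r[of _ _ "offdiag _ k"]
    by (simp add: row_add'_nth[of i y A, unfolded jk] ne ne[symmetric] oct_norm_add oct_norm_scale oct_inner_cnj_mult c n
      oct_inner_commute[of y] r[of ?w y ?u] power2_eq_square algebra_simps)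
qed

lemma row_add_E6: "row_add i y \<in> E6"
  by (simp add: E6_iff albert_det_row_add, rule linear_vecI; rule albert_eqI)
    (auto simp: row_add_nth oct_cnj_add oct_cnj_scale vec_eq_iff algebra_simps)

lemma row_add'_E6: "row_add' i y \<in> E6"
  by (simp add: E6_iff albert_det_row_add', rule linear_vecI; rule albert_eqI)
    (auto simp: row_add'_nth oct_cnj_add oct_cnj_scale vec_eq_iff algebra_simps)

text \<open>
The map \<open>A \<mapsto> D A D\<close> for the diagonal matrix \<open>D\<close> with entries \<open>d\<close>.
\<close>

definition diag_scale :: "(3 \<Rightarrow> 'a) \<Rightarrow> 'a::comm_ring_1 albert \<Rightarrow> 'a albert" where
  "diag_scale d A = albert_vec (\<lambda>i. d i ^ 2 * A $ Inl i) (\<lambda>i. (d (i+1) * d (i+2)) *s offdiag A i)"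

lemma diag_scale_nth:
  "diag_scale d A $ Inl i = d i ^ 2 * A $ Inl i"
  "offdiag (diag_scale d A) i = (d (i+1) * d (i+2)) *s offdiag A i"
  by (simp_all add: diag_scale_def)

lemma diag_scale_E6:
  assumes "d 0 * d 1 * d 2 = 1"
  shows "diag_scale d \<in> E6"
  unfolding E6_iff
proof (intro conjI allI linear_vecI)
  show "albert_det (diag_scale d A) = albert_det A" for A
  proof -
    have "albert_det (diag_scale d A) = (d 0 * d 1 * d 2) ^ 2 * albert_det A"
      unfolding albert_det_explicit
      by (simp add: diag_scale_nth sum_3_0 mod_3 oct_norm_scale power2_eq_square algebra_simps)
    then show ?thesis by (simp add: assms)
  qed
  show "diag_scale d (A + B) = diag_scale d A + diag_scale d B" for A B
    by (rule albert_eqI) (simp_all add: diag_scale_nth vec_eq_iff algebra_simps)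
  show "diag_scale d (c *s A) = c *s diag_scale d A" for A c
    by (rule albert_eqI) (simp_all add: diag_scale_nth vec_eq_iff algebra_simps)
qed


section \<open>Transitivity\<close>

text \<open>
A row operation changes a diagonal entry by a polynomial of this form, so a nonzero entry elsewhere
can be used to make a vanishing diagonal entry nonzero.
\<close>

lemma exists_diag_shift_nonzero:
  fixes x :: "'a::field_char_0 oct"
  assumes "x \<noteq> 0 \<or> c \<noteq> 0"
  shows "\<exists>y. 2 * oct_inner y x + oct_norm y * c \<noteq> 0"
proof (cases "x = 0")
  case True
  have "oct_norm (oct_scalar 1 :: 'a oct) = 1"
    by (simp add: oct_norm_def sum_8)
  then show ?thesis using assms True by (intro exI[of _ "oct_scalar 1"]) simp
next
  case False
  then obtain k where k: "x $ k \<noteq> 0" by (auto simp: vec_eq_iff)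
  let ?y = "axis k 1 :: 'a oct"
  have n: "oct_norm ?y = 1" by (simp flip: oct_inner_self)
  show ?thesis
  proof (rule ccontr)
    assume *: "\<not> ?thesis"
    have "2 * x $ k + c = 0" using *[simplified, rule_format, of ?y] by (simp add: n)
    moreover have "- 2 * x $ k + c = 0"
      using *[simplified, rule_format, of "- ?y"] n by (simp flip: oct_inner_self)
    ultimately have "4 * x $ k = 0" by algebra
    then show False using k by simp
  qed
qed

abbreviation e11 :: "complex albert" where "e11 \<equiv> axis (Inl 0) 1"

text \<open>
A row operation that involves the first row suffices, unless \<open>offdiag A 0\<close> is the only nonzero entry;
then an operation on the other two rows first makes the middle diagonal entry nonzero.
\<close>

lemma exists_E6_corner_nonzero:
  assumes "A \<noteq> 0"
  shows "\<exists>g\<in>E6. g A $ Inl 0 \<noteq> 0"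
proof -
  have one: "\<exists>g\<in>E6. g A $ Inl 0 \<noteq> 0" if "A $ Inl 0 \<noteq> 0" for A :: "complex albert"
  proof -
    have "id \<in> E6" by (simp add: E6_iff linear_vecI)
    then show ?thesis using that by (intro bexI[of _ id]) auto
  qed
  have two: "\<exists>g\<in>E6. g A $ Inl 0 \<noteq> 0" if nz: "A $ Inl 1 \<noteq> 0 \<or> offdiag A 2 \<noteq> 0" for A :: "complex albert"
  proof (cases "A $ Inl 0 = 0")
    case True
    obtain y where "2 * oct_inner y (offdiag A 2) + oct_norm y * A $ Inl 1 \<noteq> 0"
      using exists_diag_shift_nonzero[of "offdiag A 2" "A $ Inl 1"] nz by blast
    then have "row_add 2 y A $ Inl 0 \<noteq> 0"
      by (simp add: row_add_nth mod_3 True)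
    then show ?thesis using row_add_E6 by blast
  qed (rule one)
  have three: "\<exists>g\<in>E6. g A $ Inl 0 \<noteq> 0" if nz: "A $ Inl 2 \<noteq> 0 \<or> offdiag A 1 \<noteq> 0" for A :: "complex albert"
  proof (cases "A $ Inl 0 = 0")
    case True
    obtain y where "2 * oct_inner y (offdiag A 1) + oct_norm y * A $ Inl 2 \<noteq> 0"
      using exists_diag_shift_nonzero[of "offdiag A 1" "A $ Inl 2"] nz by blast
    then have "row_add' 1 y A $ Inl 0 \<noteq> 0"
      by (simp add: row_add'_nth mod_3 True)
    then show ?thesis using row_add'_E6 by blast
  qed (rule one)
  show ?thesis
  proof (cases "A $ Inl 1 \<noteq> 0 \<or> offdiag A 2 \<noteq> 0 \<or> A $ Inl 2 \<noteq> 0 \<or> offdiag A 1 \<noteq> 0 \<or> A $ Inl 0 \<noteq> 0")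
    case True
    then show ?thesis using one two three by blast
  next
    case False
    then have x0: "offdiag A 0 \<noteq> 0"
      using assms by (auto simp: albert_eq_iff_3)
    obtain y where "2 * oct_inner y (offdiag A 0) + oct_norm y * A $ Inl 2 \<noteq> 0"
      using exists_diag_shift_nonzero x0 by blast
    then have "row_add 0 y A $ Inl 1 \<noteq> 0"
      using False by (simp add: row_add_nth mod_3)
    then obtain g where "g \<in> E6" "g (row_add 0 y A) $ Inl 0 \<noteq> 0"
      using two by blast
    then show ?thesis
      by (intro bexI[of _ "g \<circ> row_add 0 y"] E6_comp row_add_E6) simp_all
  qed
qed

lemma exists_square_root: "\<exists>s. s ^ 2 = (c::complex)"
  by (metis power2_csqrt)

text \<open>
Clear the first row and column with the nonzero corner as pivot.  For an element of rank one, the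
remaining \<open>2 \<times> 2\<close> block then vanishes, because the minors that contain the pivot do.  The determinant
is not affected by the final scaling of the corner by \<open>s\<^sup>2\<close>, which is compensated in the block.
\<close>

lemma E6_transitive:
  assumes "v \<noteq> 0" "cross v v = 0"
  shows "\<exists>g\<in>E6. g v = e11"
proof -
  obtain g where g: "g \<in> E6" and a: "g v $ Inl 0 \<noteq> 0"
    using exists_E6_corner_nonzero[OF assms(1)] by blast
  define A where "A = g v"
  \<comment> \<open>The first step clears the octonion at position \<open>(2, 0)\<close>, the second the one at \<open>(0, 1)\<close>.\<close>
  define B where "B = row_add 1 (- (1 / A $ Inl 0) *s offdiag A 1) A"
  define C where "C = row_add' 2 (- (1 / A $ Inl 0) *s offdiag B 2) B"
  have "cross (g v) (g v) = 0"
    by (simp only: E6_cross_eq_0_iff[OF g] assms(2))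
  then have CC: "cross C C = 0"
    by (simp only: C_def B_def A_def E6_cross_eq_0_iff[OF row_add_E6] E6_cross_eq_0_iff[OF row_add'_E6])
  have B: "B $ Inl 0 = A $ Inl 0" "offdiag B 1 = 0"
    using a by (simp_all add: B_def row_add_nth mod_3 A_def vec_eq_iff)
  have C: "C $ Inl 0 = A $ Inl 0" "offdiag C 1 = 0" "offdiag C 2 = 0"
    using a B by (simp_all add: C_def row_add'_nth mod_3 A_def vec_eq_iff)
  have "cross C C $ Inl 1 = 0" "cross C C $ Inl 2 = 0" "offdiag (cross C C) 0 = 0"
    by (simp_all add: CC)
  then have C': "C $ Inl 1 = 0" "C $ Inl 2 = 0" "offdiag C 0 = 0"
    using C a by (simp_all add: cross_self_nth mod_3 A_def oct_norm_def)
  obtain s where s: "s ^ 2 = 1 / A $ Inl 0"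
    using exists_square_root by blast
  then have s0: "s \<noteq> 0" using a by (auto simp: A_def)
  define d where "d = (\<lambda>i::3. if i = 0 then s else if i = 1 then 1 / s else 1)"
  have d: "diag_scale d \<in> E6"
    by (rule diag_scale_E6) (simp add: d_def s0)
  have "diag_scale d C = e11"
    using a by (simp add: albert_eq_iff_3 diag_scale_nth C C' axis_nth_if d_def s A_def)
  then have "(diag_scale d \<circ> (row_add' 2 (- (1 / A $ Inl 0) *s offdiag B 2)
      \<circ> (row_add 1 (- (1 / A $ Inl 0) *s offdiag A 1) \<circ> g))) v = e11"
    by (simp add: C_def B_def A_def)
  moreover have "diag_scale d \<circ> (row_add' 2 (- (1 / A $ Inl 0) *s offdiag B 2)
      \<circ> (row_add 1 (- (1 / A $ Inl 0) *s offdiag A 1) \<circ> g)) \<in> E6"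
    by (intro E6_comp d g row_add_E6 row_add'_E6)
  ultimately show ?thesis by blast
qed

definition corner_stabilizer :: "(complex albert \<Rightarrow> complex albert) set" where
  "corner_stabilizer = {g \<in> E6. g e11 = e11}"

lemma corner_stabilizer_comp: "g \<in> corner_stabilizer \<Longrightarrow> h \<in> corner_stabilizer \<Longrightarrow> g \<circ> h \<in> corner_stabilizer"
  by (simp add: corner_stabilizer_def E6_comp)

lemma row_add_corner_stabilizer:
  "row_add 0 y \<in> corner_stabilizer" "row_add' 0 y \<in> corner_stabilizer" "row_add 2 y \<in> corner_stabilizer" "row_add' 1 y \<in> corner_stabilizer"
  by (simp_all add: corner_stabilizer_def row_add_E6 row_add'_E6 albert_eq_iff_3 row_add_nth row_add'_nth mod_3 axis_nth_if)

text \<open>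
The minor complementary to the corner is \<open>N(A, A, diag(1, 0, 0)) / 2\<close>.
\<close>

lemma corner_stabilizer_minor:
  assumes "g \<in> corner_stabilizer"
  shows "cross (g A) (g A) $ Inl 0 = cross A A $ Inl 0"
proof -
  have g: "g \<in> E6" and f: "g e11 = e11" using assms by (auto simp: corner_stabilizer_def)
  have "cubic_polar (g A) (g A) e11 = cubic_polar A A e11"
    using E6_cubic_polar[OF g, of A A e11] by (simp only: f)
  then show ?thesis by (simp add: cubic_polar_def trace_form_axis)
qed

text \<open>
Elimination that fixes \<open>diag(1, 0, 0)\<close>: the operations between the last two rows, scalings, and the
addition of the last two rows to the first.  They turn the lower right block of determinant 1 into the
identity matrix and then clear the rest of the first row; the corner becomes the determinant.
\<close>

lemma corner_stabilizer_normal_form: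
  assumes "albert_det B = 1" "cross B B $ Inl 0 = 2"
  shows "\<exists>g\<in>corner_stabilizer. g B = albert_one"
proof -
  have "\<exists>g\<in>corner_stabilizer. g B $ Inl 1 \<noteq> 0"
  proof (cases "B $ Inl 1 = 0")
    case False
    have "id \<in> corner_stabilizer" by (simp add: corner_stabilizer_def E6_iff linear_vecI)
    then show ?thesis using False by (intro bexI[of _ id]) auto
  next
    case True
    have "offdiag B 0 \<noteq> 0"
      using assms(2) True by (auto simp: cross_self_nth oct_norm_def)
    then obtain y where "2 * oct_inner y (offdiag B 0) + oct_norm y * B $ Inl 2 \<noteq> 0"
      using exists_diag_shift_nonzero by blast
    then have "row_add 0 y B $ Inl 1 \<noteq> 0"
      by (simp add: row_add_nth mod_3 True)
    then show ?thesis using row_add_corner_stabilizer by blast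
  qed
  then obtain g where g: "g \<in> corner_stabilizer" and b: "g B $ Inl 1 \<noteq> 0" by blast
  \<comment> \<open>The lower right block becomes diagonal in \<open>D\<close> and the identity in \<open>E\<close>; then \<open>F\<close> and \<open>G\<close> clear the first row.\<close>
  define C where "C = g B"
  define D where "D = row_add' 0 (- (1 / C $ Inl 1) *s offdiag C 0) C"
  obtain s where s: "s ^ 2 = 1 / C $ Inl 1"
    using exists_square_root by blast
  then have s0: "s \<noteq> 0" using b by (auto simp: C_def)
  define d where "d = (\<lambda>i::3. if i = 0 then 1 else if i = 1 then s else 1 / s)"
  have d: "diag_scale d \<in> corner_stabilizer"
    by (simp add: corner_stabilizer_def diag_scale_E6 d_def s0 albert_eq_iff_3 diag_scale_nth axis_nth_if)
  define E where "E = diag_scale d D"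
  define F where "F = row_add 2 (- offdiag E 2) E"
  define G where "G = row_add' 1 (- offdiag F 1) F"
  have D: "D $ Inl 1 = C $ Inl 1" "offdiag D 0 = 0"
    using b by (simp_all add: D_def row_add'_nth mod_3 C_def vec_eq_iff)
  have E: "E $ Inl 1 = 1" "offdiag E 0 = 0"
    using b by (simp_all add: E_def diag_scale_nth mod_3 C_def D d_def s)
  have "cross E E $ Inl 0 = 2"
    by (simp only: E_def D_def C_def corner_stabilizer_minor[OF d] corner_stabilizer_minor[OF row_add_corner_stabilizer(2)] corner_stabilizer_minor[OF g] assms(2))
  then have E2: "E $ Inl 2 = 1"
    by (simp add: cross_self_nth E oct_norm_def)
  have F: "F $ Inl 1 = 1" "F $ Inl 2 = 1" "offdiag F 0 = 0" "offdiag F 2 = 0"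
    by (simp_all add: F_def row_add_nth mod_3 E E2)
  have G: "G $ Inl 1 = 1" "G $ Inl 2 = 1" "offdiag G 0 = 0" "offdiag G 2 = 0" "offdiag G 1 = 0"
    by (simp_all add: G_def row_add'_nth mod_3 F)
  define h where "h = row_add' 1 (- offdiag F 1) \<circ> (row_add 2 (- offdiag E 2) \<circ>
    (diag_scale d \<circ> (row_add' 0 (- (1 / C $ Inl 1) *s offdiag C 0) \<circ> g)))"
  have h: "h \<in> corner_stabilizer"
    unfolding h_def by (intro corner_stabilizer_comp d g row_add_corner_stabilizer)
  have hB: "h B = G"
    by (simp add: h_def G_def F_def E_def D_def C_def)
  have "albert_det G = 1"
    using h E6_det[of h B] by (simp add: corner_stabilizer_def hB assms(1))
  then have "G $ Inl 0 = 1"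
    by (simp add: albert_det_explicit sum_3_0 G oct_norm_def)
  then have "G = albert_one"
    by (simp add: albert_eq_iff_3 G)
  with h hB show ?thesis by blast
qed

text \<open>
By \<open>2 tr A = N(1, 1, A)\<close>, the trace is carried by \<open>g\<close> to the derivative of the determinant at \<open>g 1\<close>.
\<close>

lemma albert_trace_E6_inv:
  assumes "g \<in> E6"
  shows "2 * albert_trace (inv g A) = cubic_polar (g albert_one) (g albert_one) A"
proof -
  have "cubic_polar (g albert_one) (g albert_one) A = cubic_polar albert_one albert_one (inv g A)"
    using E6_cubic_polar[OF assms, of albert_one albert_one "inv g A"] by (simp only: E6_inv_cancel[OF assms])
  also have "\<dots> = 2 * albert_trace (inv g A)"
    by (simp add: cubic_polar_one albert_trace_one trace_form_commute[of albert_one] trace_form_one)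
  finally show ?thesis by simp
qed

text \<open>
A map \<open>g\<close> in \<open>E\<^sub>6\<close> from \<open>P\<close> to \<open>diag(1, 0, 0)\<close> need not fix the identity.  Followed by an element of the
stabilizer of \<open>diag(1, 0, 0)\<close> that moves \<open>g 1\<close> back to the identity, it becomes an automorphism.
\<close>

lemma F4_transitive:
  assumes P: "P \<in> OP2"
  shows "\<exists>g\<in>F4. g e11 = P"
proof -
  have "albert_trace P = 1" and PP: "cross P P = 0"
    using P by (auto simp: OP2_iff)
  then have "P \<noteq> 0" by (auto simp: albert_trace_def)
  then obtain g where g: "g \<in> E6" and gP: "g P = e11"
    using E6_transitive PP by blast
  define B where "B = g albert_one"
  have 1: "albert_det B = 1"
    by (simp only: B_def E6_det[OF g] albert_det_one)
  have "cubic_polar B B e11 = 2"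
    using albert_trace_E6_inv[OF g, of e11] \<open>albert_trace P = 1\<close>
    by (simp add: B_def E6_inv_cancel(2)[OF g] flip: gP)
  then have "cross B B $ Inl 0 = 2"
    by (simp add: cubic_polar_def trace_form_axis)
  then obtain h where h: "h \<in> E6" "h e11 = e11" "h B = albert_one"
    using corner_stabilizer_normal_form[OF 1] by (auto simp: corner_stabilizer_def)
  have hg: "h \<circ> g \<in> E6"
    by (rule E6_comp[OF h(1) g])
  have "inv (h \<circ> g) albert_one = albert_one" "inv (h \<circ> g) e11 = P"
    using E6_inv_cancel(2)[OF hg, of albert_one] E6_inv_cancel(2)[OF hg, of P] h gP
    by (simp_all add: B_def)
  then show ?thesis
    using F4I[OF E6_inv[OF hg]] by blast
qed


section \<open>Orbits in projective space\<close>

lemma linear_image_span: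
  assumes "Vector_Spaces.linear (*s) (*s) g"
  shows "g ` vec.span {v} = vec.span {g v}"
  by (auto simp: vec.span_singleton linear_vecD[OF assms] image_iff)

text \<open>
The predicate is meant to be invariant under scaling; then \<open>span_in_lines_where\<close> decides membership.
\<close>

definition lines_where :: "(complex ^ 'n \<Rightarrow> bool) \<Rightarrow> (complex ^ 'n) set set" where
  "lines_where P = {vec.span {v} |v. v \<noteq> 0 \<and> P v}"

lemma span_eq_imp_scale:
  assumes "vec.span {v} = vec.span {w :: complex ^ 'n}" "v \<noteq> 0"
  shows "\<exists>c. c \<noteq> 0 \<and> v = c *s w"
proof -
  have "v \<in> vec.span {w}" using assms(1) by (metis vec.span_base singletonI)
  then show ?thesis using assms(2) by (auto simp: vec.span_singleton)
qed

lemma span_scale: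
  assumes "c \<noteq> 0"
  shows "vec.span {c *s v} = vec.span {v :: complex ^ 'n}"
  using assms vec.span_image_scale[of "{v}" "\<lambda>_. c"] by simp

lemma span_in_lines_where:
  assumes "\<And>c v. c \<noteq> 0 \<Longrightarrow> P (c *s v) = P v"
  shows "vec.span {v} \<in> lines_where P \<longleftrightarrow> v \<noteq> 0 \<and> P v"
proof
  assume "vec.span {v} \<in> lines_where P"
  then obtain w where w: "vec.span {v} = vec.span {w}" "w \<noteq> 0" "P w"
    by (auto simp: lines_where_def)
  then obtain c where c: "c \<noteq> 0" "w = c *s v"
    using span_eq_imp_scale[of w v] by auto
  then show "v \<noteq> 0 \<and> P v"
    using w assms by auto
qed (auto simp: lines_where_def)

lemma lines_where_proj_space: "lines_where P \<subseteq> proj_space"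
  by (auto simp: lines_where_def proj_space_def)

lemma cross_scale_eq_0:
  "cross (c *s v) (c *s v) = 0 \<longleftrightarrow> cross v v = 0" if "c \<noteq> 0" for c :: complex
proof -
  have "cross v (c *s v) = c *s cross v v"
    by (subst cross_commute) (rule cross_linear(2))
  then show ?thesis
    using that by (simp add: cross_linear(2))
qed

lemmas span_in_rank_one_lines = span_in_lines_where[of "\<lambda>v :: complex albert. cross v v = 0", OF cross_scale_eq_0]

text \<open>
By transitivity on vectors of rank one, and because the rank one condition is invariant.
\<close>

lemma E6_line_orbit:
  assumes "v \<noteq> 0" "cross v v = 0"
  shows "line_orbit E6 (vec.span {v}) = lines_where (\<lambda>v. cross v v = 0)"
proof (intro equalityI subsetI)
  fix l assume "l \<in> line_orbit E6 (vec.span {v})"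
  then obtain g where g: "g \<in> E6" and "l = g ` vec.span {v}"
    unfolding line_orbit_def by blast
  then have l: "l = vec.span {g v}"
    by (simp only: linear_image_span[OF E6_linear])
  have "g v \<noteq> 0"
    using assms(1) by (simp only: E6_eq_0_iff[OF g] not_False_eq_True)
  moreover have "cross (g v) (g v) = 0"
    by (simp only: E6_cross_eq_0_iff[OF g] assms(2))
  ultimately show "l \<in> lines_where (\<lambda>v. cross v v = 0)"
    by (auto simp: lines_where_def l)
next
  fix l assume "l \<in> lines_where (\<lambda>v :: complex albert. cross v v = 0)"
  then obtain u where u: "u \<noteq> 0" "cross u u = 0" and l: "l = vec.span {u}"
    by (auto simp: lines_where_def)
  obtain g where g: "g \<in> E6" "g v = e11"
    using E6_transitive[OF assms] by blast
  obtain h where h: "h \<in> E6" "h u = e11"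
    using E6_transitive[OF u] by blast
  have hg: "inv h \<circ> g \<in> E6"
    by (intro E6_comp E6_inv g h)
  have hgv: "(inv h \<circ> g) v = u"
    using E6_inv_cancel(2)[OF h(1), of u] by (simp add: g h)
  have "(inv h \<circ> g) ` vec.span {v} = l"
    by (simp only: linear_image_span[OF E6_linear[OF hg]] hgv l)
  with hg show "l \<in> line_orbit E6 (vec.span {v})"
    unfolding line_orbit_def by blast
qed

text \<open>
A nonzero element \<open>Q\<close> of rank one satisfies \<open>Q \<star> Q = tr(Q) Q\<close>, so nonzero idempotents of rank one have
nonzero trace.  Conversely, a rank one element of nonzero trace is a multiple of a point of the plane.
\<close>

lemma F4_line_orbit:
  "line_orbit F4 (vec.span {e11}) = lines_where (\<lambda>v. cross v v = 0 \<and> albert_trace v \<noteq> 0)"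
proof (intro equalityI subsetI)
  fix l assume "l \<in> line_orbit F4 (vec.span {e11})"
  then obtain g where g: "g \<in> F4" and l: "l = g ` vec.span {e11}"
    by (auto simp: line_orbit_def)
  have gE: "g \<in> E6" using g by (simp add: F4_def)
  have "e11 \<in> OP2"
    by (simp add: OP2_iff cross_idempotent_axis albert_trace_def sum_3_0 axis_nth_if)
  then have e: "e11 \<star> e11 = e11" by (simp add: OP2_def)
  have nz: "g e11 \<noteq> 0"
    by (simp only: E6_eq_0_iff[OF gE] axis_eq_0_iff) simp
  have c: "cross (g e11) (g e11) = 0"
    by (simp only: E6_cross_eq_0_iff[OF gE] cross_idempotent_axis)
  have "g (e11 \<star> e11) = g e11 \<star> g e11"
    using g by (simp add: F4_def)
  then have "g e11 \<star> g e11 = g e11"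
    by (simp only: e)
  moreover have "g e11 \<star> g e11 = albert_trace (g e11) *s g e11"
    by (simp add: jordan_self c)
  ultimately have "albert_trace (g e11) \<noteq> 0"
    using nz by (auto simp: vec_eq_iff)
  then show "l \<in> lines_where (\<lambda>v. cross v v = 0 \<and> albert_trace v \<noteq> 0)"
    using nz c by (auto simp: lines_where_def l linear_image_span[OF E6_linear[OF gE]])
next
  fix l assume "l \<in> lines_where (\<lambda>v :: complex albert. cross v v = 0 \<and> albert_trace v \<noteq> 0)"
  then obtain u where u: "u \<noteq> 0" "cross u u = 0" "albert_trace u \<noteq> 0" and l: "l = vec.span {u}"
    by (auto simp: lines_where_def)
  define P where "P = (1 / albert_trace u) *s u"
  have P: "P \<in> OP2" "vec.span {P} = l"
    using u by (simp_all add: OP2_iff P_def cross_scale_eq_0 albert_trace_linear l span_scale)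
  obtain g where "g \<in> F4" "g e11 = P"
    using F4_transitive[OF P(1)] by blast
  moreover from this have "g ` vec.span {e11} = l"
    using P(2) by (simp add: linear_image_span[OF E6_linear] F4_def)
  ultimately show "l \<in> line_orbit F4 (vec.span {e11})"
    by (auto simp: line_orbit_def)
qed


section \<open>The open orbit as the complexified plane\<close>

lemma linear_form_bounded_linear:
  assumes "Vector_Spaces.linear (*s) (*) (f :: complex ^ 'n \<Rightarrow> complex)"
  shows "bounded_linear f"
proof (rule linear_conv_bounded_linear[THEN iffD1], rule linearI)
  show "f (x + y) = f x + f y" for x y by (rule linear_formD[OF assms])
  have "r *\<^sub>R x = complex_of_real r *s x" for r and x :: "complex ^ 'n"
    by (simp add: vec_eq_iff scaleR_conv_of_real[where 'a = complex])
  then show "f (r *\<^sub>R x) = r *\<^sub>R f x" for r x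
    by (simp add: linear_formD[OF assms] scaleR_conv_of_real)
qed

lemma has_complex_derivative_affine:
  assumes "Vector_Spaces.linear (*s) (*) (f :: complex ^ 'n \<Rightarrow> complex)"
  shows "has_complex_derivative (\<lambda>x. f x - b) f p"
  unfolding has_complex_derivative_def
  using assms bounded_linear_imp_has_derivative[OF linear_form_bounded_linear[OF assms], of "at p"]
  by (auto intro!: derivative_eq_intros)

lemma has_complex_derivative_quadratic:
  fixes B :: "complex ^ 'n \<Rightarrow> complex ^ 'n \<Rightarrow> complex"
  assumes lin: "\<And>x. Vector_Spaces.linear (*s) (*) (B x)" and sym: "\<And>x y. B x y = B y x"
  shows "has_complex_derivative (\<lambda>x. B x x) (\<lambda>h. 2 * B p h) p"
proof -
  have l: "linear (B x)" for x
    using linear_form_bounded_linear[OF lin] by (simp add: linear_conv_bounded_linear)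
  have "(\<lambda>x. B x y) = B y" for y using sym by auto
  then have "bilinear B"
    unfolding bilinear_def using l by simp
  then interpret B: bounded_bilinear B
    by (simp add: bilinear_conv_bounded_bilinear)
  have "((\<lambda>x. B x x) has_derivative (\<lambda>h. B p h + B h p)) (at p)"
    by (rule B.FDERIV) (rule has_derivative_ident)+
  moreover have "(\<lambda>h. B p h + B h p) = (\<lambda>h. 2 * B p h)"
    using sym by auto
  moreover have "Vector_Spaces.linear (*s) (*) (\<lambda>h. 2 * B p h)"
    by (rule linear_formI) (simp_all add: linear_formD[OF lin] algebra_simps)
  ultimately show ?thesis
    by (simp add: has_complex_derivative_def)
qed

lemma albert_trace_linear_form: "Vector_Spaces.linear (*s) (*) (albert_trace :: complex albert \<Rightarrow> complex)"
  by (rule linear_formI) (simp_all add: albert_trace_linear)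

lemma open_trace_nonzero: "open {v :: complex albert. albert_trace v \<noteq> 0}"
proof -
  have "continuous_on UNIV (albert_trace :: complex albert \<Rightarrow> complex)"
    by (rule linear_continuous_on[OF linear_form_bounded_linear[OF albert_trace_linear_form]])
  then have "open (albert_trace -` (- {0 :: complex}))"
    by (rule open_vimage[rotated]) auto
  then show ?thesis by (simp add: vimage_def)
qed

text \<open>
The inverse is \<open>[v] \<mapsto> v / tr v\<close>, which is holomorphic where the trace does not vanish.
\<close>

lemma OP2_biholomorphic:
  "biholomorphic_to_proj (\<lambda>P. vec.span {P}) OP2 (lines_where (\<lambda>v. cross v v = 0 \<and> albert_trace v \<noteq> 0))"
  (is "biholomorphic_to_proj ?f OP2 ?Y")
proof -
  have inY: "vec.span {v} \<in> ?Y \<longleftrightarrow> v \<noteq> 0 \<and> cross v v = 0 \<and> albert_trace v \<noteq> 0" for v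
    by (rule span_in_lines_where) (simp add: cross_scale_eq_0 albert_trace_linear)
  have nz: "P \<noteq> 0" if "P \<in> OP2" for P :: "complex albert"
    using that by (auto simp: OP2_iff albert_trace_def)
  have inj: "inj_on ?f OP2"
  proof (rule inj_onI)
    fix P Q :: "complex albert" assume PQ: "P \<in> OP2" "Q \<in> OP2" "vec.span {P} = vec.span {Q}"
    then obtain c where "P = c *s Q" using span_eq_imp_scale[of P Q] nz by blast
    then show "P = Q" using PQ by (auto simp: OP2_iff albert_trace_linear)
  qed
  have norm: "(1 / albert_trace v) *s v \<in> OP2" "vec.span {(1 / albert_trace v) *s v} = vec.span {v}"
    if "cross v v = 0" "albert_trace v \<noteq> 0" for v :: "complex albert"
    using that by (simp_all add: OP2_iff cross_scale_eq_0 albert_trace_linear span_scale)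
  have "?f ` OP2 = ?Y"
  proof (intro equalityI subsetI)
    fix l assume "l \<in> ?f ` OP2"
    then obtain P where P: "P \<in> OP2" "l = vec.span {P}" by blast
    show "l \<in> ?Y"
      using P(1) nz[OF P(1)] unfolding P(2) inY OP2_iff by simp
  next
    fix l assume "l \<in> ?Y"
    then obtain v where v: "l = vec.span {v}" "cross v v = 0" "albert_trace v \<noteq> 0"
      unfolding lines_where_def by blast
    show "l \<in> ?f ` OP2"
      unfolding v(1) by (rule image_eqI[OF _ norm(1)[OF v(2,3)]]) (rule norm(2)[OF v(2,3), symmetric])
  qed
  with inj have bij: "bij_betw ?f OP2 ?Y" by (simp add: bij_betw_def)
  have into: "holomorphic_into_proj ?f OP2"
    unfolding holomorphic_into_proj_def
  proof
    fix P :: "complex albert" assume "P \<in> OP2"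
    have "has_complex_derivative (\<lambda>x :: complex albert. x $ i - 0) (\<lambda>x. x $ i) p" for i p
      by (rule has_complex_derivative_affine, rule linear_formI) simp_all
    then have "holomorphic_map_on (\<lambda>x :: complex albert. x) UNIV"
      unfolding holomorphic_map_on_def holomorphic_fun_on_def by auto
    then show "\<exists>U F. open U \<and> P \<in> U \<and> holomorphic_map_on F U \<and> (\<forall>x\<in>U \<inter> OP2. F x \<noteq> 0 \<and> vec.span {x} = vec.span {F x})"
      using nz by (intro exI[of _ UNIV] exI[of _ "\<lambda>x. x"]) auto
  qed
  have inv_f: "inv_into OP2 ?f (vec.span {v}) = (1 / albert_trace v) *s v"
    if "cross v v = 0" "albert_trace v \<noteq> 0" for v
    using inv_into_f_f[OF inj norm(1)[OF that]] by (simp only: norm(2)[OF that])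
  have inverse_hol: "holomorphic_from_proj (inv_into OP2 ?f) ?Y"
    unfolding holomorphic_from_proj_def
  proof (intro allI impI)
    fix v :: "complex albert" assume v: "v \<noteq> 0 \<and> vec.span {v} \<in> ?Y"
    let ?U = "{v :: complex albert. albert_trace v \<noteq> 0}" and ?G = "\<lambda>v. (1 / albert_trace v) *s v"
    have "\<exists>D. has_complex_derivative (\<lambda>x. ?G x $ i) D x" if x: "albert_trace x \<noteq> 0" for i and x :: "complex albert"
    proof (intro exI)
      let ?D = "\<lambda>h. h $ i / albert_trace x - albert_trace h * x $ i / (albert_trace x) ^ 2"
      have li: "Vector_Spaces.linear (*s) (*) (\<lambda>x :: complex albert. x $ i)"
        by (rule linear_formI) simp_all
      have "Vector_Spaces.linear (*s) (*) ?D"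
        using x by (intro linear_formI) (simp_all add: albert_trace_linear field_simps)
      moreover have "((\<lambda>x. x $ i / albert_trace x) has_derivative ?D) (at x)"
        using bounded_linear_imp_has_derivative[OF linear_form_bounded_linear[OF albert_trace_linear_form], of "at x"]
          bounded_linear_imp_has_derivative[OF linear_form_bounded_linear[OF li], of "at x"] x
        by (auto intro!: derivative_eq_intros simp: field_simps power2_eq_square)
      ultimately show "has_complex_derivative (\<lambda>x. ?G x $ i) ?D x"
        by (simp add: has_complex_derivative_def)
    qed
    then have "holomorphic_map_on ?G ?U"
      unfolding holomorphic_map_on_def holomorphic_fun_on_def by blast
    then show "\<exists>U G. open U \<and> v \<in> U \<and> holomorphic_map_on G U \<and>
        (\<forall>x\<in>U. x \<noteq> 0 \<and> vec.span {x} \<in> ?Y \<longrightarrow> inv_into OP2 ?f (vec.span {x}) = G x)"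
      using open_trace_nonzero v inv_f by (intro exI[of _ ?U] exI[of _ ?G]) (auto simp: inY)
  qed
  show ?thesis
    unfolding biholomorphic_to_proj_def using bij into inverse_hol by blast
qed


section \<open>Linear sections of the cone of rank one elements\<close>

lemma sum_lessThan_add: "sum f {..<a + b} = sum f {..<a} + (\<Sum>j<b. f (a + j))"
  for f :: "nat \<Rightarrow> 'a::comm_monoid_add"
  by (induction b) (simp_all add: add.assoc)

lemma all_less_add_iff: "(\<forall>i<a + b. P i) \<longleftrightarrow> (\<forall>i<a. P i) \<and> (\<forall>j<b. P (a + j))" for a b :: nat
proof (intro iffI allI impI)
  fix i assume *: "(\<forall>i<a. P i) \<and> (\<forall>j<b. P (a + j))" and "i < a + b"
  then show "P i"
    by (cases "i < a") (auto dest!: spec[of _ "i - a"])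
qed auto

text \<open>
The coordinates that are normal to the cone of rank one at \<open>diag(1, 0, 0)\<close>: the lower right
\<open>2 \<times> 2\<close> block.
\<close>

definition normal_coords :: "(3 + 3 \<times> 8) set" where
  "normal_coords = {Inl 1, Inl 2} \<union> range (\<lambda>k. Inr (0, k))"

lemma card_normal_coords: "card normal_coords = 10"
proof -
  have "card (range (\<lambda>k::8. Inr (0, k) :: 3 + 3 \<times> 8)) = 8"
    by (subst card_image) (auto simp: inj_on_def)
  then show ?thesis
    unfolding normal_coords_def by (subst card_Un_disjoint) auto
qed

lemma cross_e11:
  "cross e11 A $ Inl 0 = 0" "cross e11 A $ Inl 1 = A $ Inl 2" "cross e11 A $ Inl 2 = A $ Inl 1"
  "offdiag (cross e11 A) 0 = - offdiag A 0" "offdiag (cross e11 A) 1 = 0" "offdiag (cross e11 A) 2 = 0"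
  by (simp_all add: cross_nth axis_nth_if mod_3)

text \<open>
Multiplication by \<open>diag(1, 0, 0)\<close> is the adjugate on the lower right block, an involution.
\<close>

lemma cross_e11_normal:
  assumes "c \<in> normal_coords"
  shows "cross e11 (cross e11 (axis c 1)) = axis c 1"
  using assms by (auto simp: normal_coords_def albert_eq_iff_3 cross_e11 axis_nth_if)

text \<open>
The ten equations determine the lower right block from the first row when the pivot is invertible.
The other entries of \<open>A \<times> A\<close>, multiplied by powers of the pivot, then vanish by the composition law and
the alternative laws.
\<close>

lemma cross_self_eq_0_local:
  assumes a0: "A $ Inl 0 \<noteq> 0" and J: "\<And>c. c \<in> normal_coords \<Longrightarrow> cross A A $ c = 0"
  shows "cross A A = (0 :: 'a::field_char_0 albert)"
proof -
  let ?a = "\<lambda>i. A $ Inl i" and ?x = "offdiag A"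
  have "cross A A $ Inl 1 = 0" "cross A A $ Inl 2 = 0"
    using J by (auto simp: normal_coords_def)
  then have 1: "?a 0 * ?a 2 = oct_norm (?x 1)" and 2: "?a 0 * ?a 1 = oct_norm (?x 2)"
    by (simp_all add: cross_self_nth mod_3 mult.commute)
  have "offdiag (cross A A) 0 = 0"
    using J by (simp add: vec_eq_iff offdiag_nth normal_coords_def)
  then have 0: "?a 0 *s ?x 0 = oct_cnj (oct_mult (?x 1) (?x 2))"
    by (simp add: cross_self_nth vec_eq_iff)
  have "?a 0 ^ 2 * oct_norm (?x 0) = oct_norm (?x 1) * oct_norm (?x 2)"
    by (simp add: oct_norm_mult flip: oct_norm_scale add: 0)
  also have "\<dots> = ?a 0 ^ 2 * (?a 1 * ?a 2)"
    by (simp add: power2_eq_square flip: 1 2)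
  finally have n: "oct_norm (?x 0) = ?a 1 * ?a 2"
    using a0 by simp
  have "?a 0 *s oct_cnj (oct_mult (?x 2) (?x 0)) = oct_cnj (oct_mult (?x 2) (?a 0 *s ?x 0))"
    by (simp add: oct_cnj_scale)
  also have "\<dots> = ?a 0 *s (?a 1 *s ?x 1)"
    by (simp only: 0 oct_cnj_mult oct_cnj_cnj oct_alternative flip: 2) (simp add: oct_alternative flip: oct_cnj_mult 2)
  finally have o1: "oct_cnj (oct_mult (?x 2) (?x 0)) = ?a 1 *s ?x 1"
    using a0 by (simp add: vec_eq_iff)
  have "?a 0 *s oct_cnj (oct_mult (?x 0) (?x 1)) = oct_cnj (oct_mult (?a 0 *s ?x 0) (?x 1))"
    by (simp add: oct_cnj_scale)
  also have "\<dots> = ?a 0 *s (?a 2 *s ?x 2)"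
    by (simp only: 0 oct_cnj_mult oct_cnj_cnj oct_alternative flip: 1) (simp add: oct_alternative flip: oct_cnj_mult 1)
  finally have o2: "oct_cnj (oct_mult (?x 0) (?x 1)) = ?a 2 *s ?x 2"
    using a0 by (simp add: vec_eq_iff)
  have o0: "oct_cnj (oct_mult (?x 1) (?x 2)) - ?a 0 *s ?x 0 = 0"
    by (simp add: 0)
  show ?thesis
    using 1 2 n o1 o2 o0 by (simp add: albert_eq_iff_3 cross_self_nth mod_3 mult.commute)
qed

text \<open>
Near a point \<open>p\<close> of rank one, choose \<open>g\<close> in \<open>E\<^sub>6\<close> with \<open>g p = diag(1, 0, 0)\<close>.  Near \<open>p\<close> the cone is the zero set
of the ten normal entries of \<open>g x \<times> g x\<close>, whose differentials at \<open>p\<close> are independent and vanish on the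
17-dimensional tangent space \<open>{w. p \<times> w = 0}\<close>.  So they stay independent when linear equations are added
that are independent on the tangent space.
\<close>

lemma linear_section_submanifold:
  fixes L :: "nat \<Rightarrow> complex albert \<Rightarrow> complex"
  assumes lin: "\<And>j. j < r \<Longrightarrow> Vector_Spaces.linear (*s) (*) (L j)"
    and dim: "r + d = 17"
    and S: "S = {v. v \<noteq> 0 \<and> cross v v = 0 \<and> (\<forall>j<r. L j v = b j)}"
    and transversal: "\<And>p c. p \<in> S \<Longrightarrow> (\<And>w. cross p w = 0 \<Longrightarrow> (\<Sum>j<r. c j * L j w) = 0) \<Longrightarrow> \<forall>j<r. c j = 0"
  shows "complex_submanifold d S"
  unfolding complex_submanifold_def
proof (intro exI[of _ "10 + r"] conjI ballI)
  show "10 + r + d = CARD(3 + 3 \<times> 8)" using dim by simp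
  fix p assume p: "p \<in> S"
  then obtain g where g: "g \<in> E6" and gp: "g p = e11"
    using E6_transitive by (auto simp: S)
  obtain e :: "nat \<Rightarrow> 3 + 3 \<times> 8" where e: "bij_betw e {..<10} normal_coords"
    using ex_bij_betw_nat_finite[of normal_coords] card_normal_coords
    by (auto simp: atLeast0LessThan)
  then have eJ: "e i \<in> normal_coords" if "i < 10" for i
    using that by (auto simp: bij_betw_def)
  have J_all: "(\<forall>c\<in>normal_coords. P c) \<longleftrightarrow> (\<forall>i<10. P (e i))" for P
    unfolding bij_betw_imp_surj_on[OF e, symmetric] by auto
  have e_inj: "e i = e j \<longleftrightarrow> i = j" if "i < 10" "j < 10" for i j
    using e that by (auto simp: bij_betw_def inj_on_def)
  define B where "B i x y = cross (g x) (g y) $ e i" for i x y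
  define F where "F i = (if i < 10 then (\<lambda>x. B i x x) else (\<lambda>x. L (i - 10) x - b (i - 10)))" for i
  define D where "D i = (if i < 10 then (\<lambda>h. 2 * B i p h) else L (i - 10))" for i
  define U where "U = {x. g x $ Inl 0 \<noteq> 0}"
  have gcoord: "Vector_Spaces.linear (*s) (*) (\<lambda>x. g x $ c)" for c
    by (rule linear_formI) (simp_all add: E6_simps[OF g])
  have Bsym: "B i x y = B i y x" for i x y
    by (simp add: B_def cross_commute)
  have Blin: "Vector_Spaces.linear (*s) (*) (B i x)" for i x
    by (rule linear_formI)
      (simp_all add: B_def E6_simps[OF g] cross_linear cross_commute[of "g x"])
  have quad: "has_complex_derivative (\<lambda>x. B i x x) (\<lambda>h. 2 * B i q h) q" for i q
    by (rule has_complex_derivative_quadratic[OF Blin Bsym])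
  have "open U"
  proof -
    have "continuous_on UNIV (\<lambda>x. g x $ Inl 0)"
      by (rule linear_continuous_on[OF linear_form_bounded_linear[OF gcoord]])
    then have "open ((\<lambda>x. g x $ Inl 0) -` (- {0}))"
      by (rule open_vimage[rotated]) auto
    then show ?thesis by (simp add: U_def vimage_def)
  qed
  moreover have "p \<in> U" by (simp add: U_def gp)
  moreover have "holomorphic_fun_on (F i) U \<and> has_complex_derivative (F i) (D i) p" if "i < 10 + r" for i
  proof (cases "i < 10")
    case True
    then show ?thesis using quad by (auto simp: F_def D_def holomorphic_fun_on_def)
  next
    case False
    then have "has_complex_derivative (F i) (L (i - 10)) q" for q
      using has_complex_derivative_affine[OF lin[of "i - 10"]] that by (simp add: F_def)
    then show ?thesis using False by (auto simp: D_def holomorphic_fun_on_def)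
  qed
  moreover have "S \<inter> U = {x \<in> U. \<forall>i<10 + r. F i x = 0}"
  proof -
    have Fz: "(\<forall>i<10 + r. F i x = 0) \<longleftrightarrow> (\<forall>i<10. B i x x = 0) \<and> (\<forall>j<r. L j x = b j)" for x
    proof -
      have "(\<forall>i<10 + r. F i x = 0) \<longleftrightarrow> (\<forall>i<10. F i x = 0) \<and> (\<forall>j<r. F (10 + j) x = 0)"
        by (rule all_less_add_iff)
      then show ?thesis by (simp add: F_def)
    qed
    have iff_U: "x \<noteq> 0 \<and> cross x x = 0 \<longleftrightarrow> (\<forall>i<10. B i x x = 0)" if "x \<in> U" for x
    proof -
      have "x \<noteq> 0" using that by (auto simp: U_def E6_simps[OF g])
      moreover have "cross (g x) (g x) = 0 \<longleftrightarrow> (\<forall>c\<in>normal_coords. cross (g x) (g x) $ c = 0)"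
        using cross_self_eq_0_local[of "g x"] that by (auto simp: U_def)
      ultimately show ?thesis
        by (auto simp: E6_cross_eq_0_iff[OF g] B_def J_all)
    qed
    show ?thesis
      unfolding S Fz using iff_U by blast
  qed
  moreover have "\<forall>i<10 + r. c i = 0" if c: "\<forall>h. (\<Sum>i<10 + r. c i * D i h) = 0" for c
  proof -
    have split: "(\<Sum>i<10. c i * (2 * B i p h)) + (\<Sum>j<r. c (10 + j) * L j h) = 0" for h
      using c[rule_format, of h] by (simp add: sum_lessThan_add D_def)
    have cL: "\<forall>j<r. c (10 + j) = 0"
    proof (rule transversal[OF p])
      fix w assume "cross p w = 0"
      then have "cross (g p) (g w) = 0" by (simp only: E6_cross_eq_0_iff[OF g])
      then show "(\<Sum>j<r. c (10 + j) * L j w) = 0"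
        using split[of w] by (simp add: B_def)
    qed
    have "c i = 0" if i: "i < 10" for i
    proof -
      \<comment> \<open>The direction dual to the \<open>i\<close>-th equation; it exists because the adjugate is an involution on the block.\<close>
      define h where "h = inv g (cross e11 (axis (e i) 1))"
      have "B j p h = (if j = i then 1 else 0)" if "j < 10" for j
        unfolding B_def h_def E6_inv_cancel(1)[OF g] gp cross_e11_normal[OF eJ[OF i]]
        using e_inj[OF that i] by (simp add: axis_nth_if)
      then have "(\<Sum>j<10. c j * (2 * B j p h)) = (\<Sum>j<10. if j = i then 2 * c i else 0)"
        by (intro sum.cong) auto
      then show ?thesis
        using split[of h] cL i by (simp add: sum.delta)
    qed
    with cL show ?thesis
      by (simp add: all_less_add_iff)
  qed
  ultimately show "\<exists>U F D. open U \<and> p \<in> U \<and>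
      (\<forall>i<10 + r. holomorphic_fun_on (F i) U \<and> has_complex_derivative (F i) (D i) p) \<and>
      S \<inter> U = {x \<in> U. \<forall>i<10 + r. F i x = 0} \<and>
      (\<forall>c. (\<forall>h. (\<Sum>i<10 + r. c i * D i h) = 0) \<longrightarrow> (\<forall>i<10 + r. c i = 0))"
    by blast
qed

text \<open>
Move \<open>p\<close> to \<open>diag(1, 0, 0)\<close> by \<open>g\<close>; then the trace becomes the derivative of the determinant at
\<open>C = g 1\<close>.  By the expansion along the first row, the derivative in the direction of the first row of
\<open>C\<close> (with the off-diagonal entries halved, because they occur twice in a Hermitian matrix) is \<open>det C = 1\<close>,
and this direction is tangent.
\<close>

lemma exists_tangent_trace_nonzero:
  fixes p :: "complex albert"
  assumes "p \<noteq> 0" "cross p p = 0"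
  shows "\<exists>w. cross p w = 0 \<and> albert_trace w \<noteq> 0"
proof -
  obtain g where g: "g \<in> E6" and gp: "g p = e11"
    using E6_transitive assms by blast
  define C where "C = g albert_one"
  define u where "u = albert_vec (\<lambda>i. if i = 0 then C $ Inl 0 else 0)
    (\<lambda>i. if i = 0 then 0 else (1 / 2) *s offdiag C i)"
  have "albert_det C = 1"
    by (simp only: C_def E6_det[OF g] albert_det_one)
  have r: "oct_mult (oct_mult (offdiag C 2) (offdiag C 0)) (offdiag C 1) $ 0
      = oct_mult (oct_mult (offdiag C 0) (offdiag C 1)) (offdiag C 2) $ 0"
    by (rule oct_trilinear_cyclic)
  have "cubic_polar C C u = 2 * albert_det C"
    unfolding cubic_polar_def trace_form_def albert_det_explicit sum_3_0
    by (simp add: cross_self_nth u_def mod_3 oct_inner_cnj_mult oct_inner_self r algebra_simps)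
  then have "albert_trace (inv g u) = 1"
    using albert_trace_E6_inv[OF g, of u] \<open>albert_det C = 1\<close> by (simp add: C_def)
  moreover have "cross p (inv g u) = 0"
  proof -
    have "cross e11 u = 0"
      by (simp add: albert_eq_iff_3 cross_e11 u_def)
    then have "cross (g p) (g (inv g u)) = 0"
      by (simp only: gp E6_inv_cancel[OF g])
    then show ?thesis by (simp only: E6_cross_eq_0_iff[OF g])
  qed
  ultimately show ?thesis by (intro exI[of _ "inv g u"]) simp
qed

lemma cayley_plane_submanifold: "proj_submanifold 16 (lines_where (\<lambda>v :: complex albert. cross v v = 0))"
  unfolding proj_submanifold_def
proof (intro conjI allI impI lines_where_proj_space)
  fix \<phi> :: "complex albert \<Rightarrow> complex" assume \<phi>: "Vector_Spaces.linear (*s) (*) \<phi>"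
  show "complex_submanifold 16 {v. \<phi> v = 1 \<and> vec.span {v} \<in> lines_where (\<lambda>v. cross v v = 0)}" (is "complex_submanifold 16 ?S")
  proof (rule linear_section_submanifold[where r = 1 and L = "\<lambda>_. \<phi>" and b = "\<lambda>_. 1"])
    show "?S = {v. v \<noteq> 0 \<and> cross v v = 0 \<and> (\<forall>j<1::nat. \<phi> v = 1)}"
      by (auto simp: span_in_rank_one_lines)
    fix p and c :: "nat \<Rightarrow> complex" assume "p \<in> ?S" and *: "\<And>w. cross p w = 0 \<Longrightarrow> (\<Sum>j<1. c j * \<phi> w) = 0"
    then show "\<forall>j<1. c j = 0" using *[of p] by (auto simp: span_in_rank_one_lines)
  qed (simp_all add: \<phi>)
qed

text \<open>
The point \<open>p\<close> is itself tangent to the cone and lies in the kernel of the trace, but not of \<open>\<phi>\<close>.  Together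
with a tangent vector of nonzero trace it shows that \<open>\<phi>\<close> and the trace are independent on the tangent
space.
\<close>

lemma trace_zero_submanifold:
  "proj_submanifold 15 (lines_where (\<lambda>v :: complex albert. cross v v = 0 \<and> albert_trace v = 0))"
  unfolding proj_submanifold_def
proof (intro conjI allI impI lines_where_proj_space)
  let ?Y = "lines_where (\<lambda>v :: complex albert. cross v v = 0 \<and> albert_trace v = 0)"
  have inY: "vec.span {v} \<in> ?Y \<longleftrightarrow> v \<noteq> 0 \<and> cross v v = 0 \<and> albert_trace v = 0" for v
    by (rule span_in_lines_where) (simp add: cross_scale_eq_0 albert_trace_linear)
  fix \<phi> :: "complex albert \<Rightarrow> complex" assume \<phi>: "Vector_Spaces.linear (*s) (*) \<phi>"
  define L where "L j = (if j = 0 then \<phi> else albert_trace)" for j :: nat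
  define b where "b j = (if j = 0 then 1 else 0 :: complex)" for j :: nat
  show "complex_submanifold 15 {v. \<phi> v = 1 \<and> vec.span {v} \<in> ?Y}" (is "complex_submanifold 15 ?S")
  proof (rule linear_section_submanifold[where r = 2 and L = L and b = b])
    show "?S = {v. v \<noteq> 0 \<and> cross v v = 0 \<and> (\<forall>j<2. L j v = b j)}"
      by (auto simp: inY L_def b_def numeral_2_eq_2 less_Suc_eq)
    fix p and c :: "nat \<Rightarrow> complex" assume p: "p \<in> ?S" and *: "\<And>w. cross p w = 0 \<Longrightarrow> (\<Sum>j<2. c j * L j w) = 0"
    have c0: "c 0 = 0"
      using *[of p] p by (auto simp: inY L_def numeral_2_eq_2)
    obtain w where "cross p w = 0" "albert_trace w \<noteq> 0"
      using exists_tangent_trace_nonzero[of p] p by (auto simp: inY)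
    then have "c 1 = 0"
      using *[of w] c0 by (auto simp: L_def numeral_2_eq_2)
    with c0 show "\<forall>j<2. c j = 0" by (auto simp: numeral_2_eq_2 less_Suc_eq)
  qed (simp_all add: L_def \<phi> albert_trace_linear_form)
qed

text \<open>
The upper left \<open>2 \<times> 2\<close> block of the example is \<open>w w\<^sup>T\<close> for the isotropic vector \<open>w = (1, \<i>)\<close>.
\<close>

lemma trace_zero_line_exists: "lines_where (\<lambda>v :: complex albert. cross v v = 0 \<and> albert_trace v = 0) \<noteq> {}"
proof -
  let ?v = "albert_vec (\<lambda>i. if i = 0 then 1 else if i = 1 then - 1 else 0)
    (\<lambda>i. if i = 2 then oct_scalar \<i> else 0) :: complex albert"
  have "oct_norm (oct_scalar \<i>) = - 1" by (simp add: oct_norm_def sum_8)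
  then have "cross ?v ?v = 0"
    by (simp add: albert_eq_iff_3 cross_self_nth mod_3 oct_norm_def[of 0])
  moreover have "?v $ Inl 0 \<noteq> 0" by simp
  then have "?v \<noteq> 0" by (metis zero_index)
  moreover have "albert_trace ?v = 0" by (simp add: albert_trace_def sum_3_0)
  ultimately show ?thesis by (auto simp: lines_where_def)
qed


section \<open>The two strata\<close>

theorem proposition3p12:
  fixes v :: "complex albert" and X :: "complex albert set set"
  assumes "extremal_weight_vector v"
    and "X = line_orbit E6 (vec.span {v})"
  shows "\<exists>Y0 Yinf. X = Y0 \<union> Yinf \<and> Y0 \<inter> Yinf = {} \<and>
    openin (subtopology proj_topology X) Y0 \<and>
    (\<exists>p\<in>X. Y0 = line_orbit F4 p) \<and>
    complexification_of_OP2 Y0 \<and>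
    has_complex_codim 1 Yinf X"
proof -
  define Y0 where "Y0 = lines_where (\<lambda>v :: complex albert. cross v v = 0 \<and> albert_trace v \<noteq> 0)"
  define Yinf where "Yinf = lines_where (\<lambda>v :: complex albert. cross v v = 0 \<and> albert_trace v = 0)"
  have "v \<noteq> 0" using assms(1) by (simp add: extremal_weight_vector_def)
  then have X: "X = lines_where (\<lambda>v. cross v v = 0)"
    unfolding assms(2) by (intro E6_line_orbit extremal_imp_cross_eq_0 assms(1))
  have inY: "vec.span {v} \<in> Y0 \<longleftrightarrow> v \<noteq> 0 \<and> cross v v = 0 \<and> albert_trace v \<noteq> 0"
    "vec.span {v} \<in> Yinf \<longleftrightarrow> v \<noteq> 0 \<and> cross v v = 0 \<and> albert_trace v = 0" for v
    unfolding Y0_def Yinf_def by (rule span_in_lines_where; simp add: cross_scale_eq_0 albert_trace_linear)+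
  have un: "X = Y0 \<union> Yinf"
    by (auto simp: X Y0_def Yinf_def lines_where_def)
  moreover have "Y0 \<inter> Yinf = {}"
  proof -
    have "l \<notin> Yinf" if "l \<in> Y0" for l
    proof -
      from that obtain v where "l = vec.span {v}" by (auto simp: Y0_def lines_where_def)
      then show ?thesis using that by (auto simp: inY)
    qed
    then show ?thesis by blast
  qed
  moreover have "openin (subtopology proj_topology X) Y0"
  proof -
    let ?T = "lines_where (\<lambda>v :: complex albert. albert_trace v \<noteq> 0)"
    have inT: "vec.span {v} \<in> ?T \<longleftrightarrow> v \<noteq> 0 \<and> albert_trace v \<noteq> 0" for v
      by (rule span_in_lines_where) (simp add: albert_trace_linear)
    have "{v :: complex albert. v \<noteq> 0 \<and> vec.span {v} \<in> ?T} = {v. albert_trace v \<noteq> 0}"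
      by (auto simp: inT)
    then have "openin proj_topology ?T"
      by (simp add: openin_proj_topology lines_where_proj_space open_trace_nonzero)
    moreover have "Y0 = ?T \<inter> X"
    proof -
      have "l \<in> Y0 \<longleftrightarrow> l \<in> ?T \<and> l \<in> X" for l
      proof (cases "\<exists>v. l = vec.span {v}")
        case True
        then show ?thesis by (auto simp: inT inY X span_in_rank_one_lines)
      next
        case False
        then show ?thesis by (auto simp: Y0_def X lines_where_def)
      qed
      then show ?thesis by blast
    qed
    ultimately show ?thesis by (auto simp: openin_subtopology)
  qed
  moreover have "\<exists>p\<in>X. Y0 = line_orbit F4 p"
  proof
    show "Y0 = line_orbit F4 (vec.span {e11})" by (simp add: Y0_def F4_line_orbit)
    show "vec.span {e11} \<in> X" by (simp add: X span_in_rank_one_lines cross_idempotent_axis axis_eq_0_iff)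
  qed
  moreover have "complexification_of_OP2 Y0"
    unfolding complexification_of_OP2_def
  proof (intro exI conjI ballI)
    show "biholomorphic_to_proj (\<lambda>P. vec.span {P}) OP2 Y0"
      unfolding Y0_def by (rule OP2_biholomorphic)
    show "vec.span {g P} = g ` vec.span {P}" if "g \<in> F4" for g P
      using that by (simp add: linear_image_span[OF E6_linear] F4_def)
  qed
  moreover have "has_complex_codim 1 Yinf X"
    unfolding has_complex_codim_def
    using trace_zero_line_exists cayley_plane_submanifold trace_zero_submanifold un
    by (auto simp: Yinf_def X intro!: exI[of _ 15])
  ultimately show ?thesis by blast
qed

end
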